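(* Let $K$ be a set of infinite cardinal numbers with $|K|=\mathbf{b}_{\omega_1}$. Then there exists a family (set) $\mathcal{F}$ of pairwise non-embeddable F-universal groups such that for every $\kappa\in K$ the family $\mathcal{F}$ contains $2^\kappa$ groups of order $\kappa$.
   Context: $\mathbf{b}_\alpha$ denotes the $\alpha$th beth number: $\mathbf{b}_0=\aleph_0$ and $\mathbf{b}_\alpha=\sup\{2^{\mathbf{b}_\beta} \mid \beta<\alpha\}$ for every ordinal $\alpha>0$. $\omega_1$ is the first uncountable ordinal. The order of a group $G$ is the cardinality $|G|$. A group is called F-universal if every finite group embeds into it. A family of groups is pairwise non-embeddable if for any two distinct members $G,H$ of the family (of equal or different orders) there is no injective group homomorphism from $G$ to $H$. *)

theory Defs
  imports "HOL-Algebra.Algebra"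
begin

unbundle cardinal_syntax

(* Cardinals are the Card_order relations of the library, compared up to =o.  Restricting the
   competing upper bounds d to the type of c loses nothing: an upper bound d <o c on any other
   type is isomorphic to a cardinal on a subset of the type of c. *)
definition is_card_sup :: "'b rel set \<Rightarrow> 'a rel \<Rightarrow> bool" where
  "is_card_sup S c \<longleftrightarrow>
     Card_order c \<and> (\<forall>s\<in>S. s \<le>o c) \<and>
     (\<forall>d :: 'a rel. Card_order d \<and> (\<forall>s\<in>S. s \<le>o d) \<longrightarrow> c \<le>o d)"

(* is_beth W c: c is the beth number whose index is the order type of the well-order W.
   The ordinals below the order type of W are those of its proper initial segments, and the beth
   numbers b i they index embed into the type of c because they are smaller than c. *)
inductive is_beth :: "'i rel \<Rightarrow> 'a rel \<Rightarrow> bool" where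
  zero: "Field W = {} \<Longrightarrow> Card_order c \<Longrightarrow> c =o natLeq \<Longrightarrow> is_beth W c"
| sup: "Well_order W \<Longrightarrow> Field W \<noteq> {} \<Longrightarrow>
    \<forall>i\<in>Field W. is_beth (Restr W (underS W i)) (b i) \<Longrightarrow>
    is_card_sup ((\<lambda>i. ctwo ^c b i) ` Field W) c \<Longrightarrow> is_beth W c"

abbreviation omega1 :: "nat set rel" where
  "omega1 \<equiv> cardSuc natLeq"

definition embeds :: "('a, 'm) monoid_scheme \<Rightarrow> ('b, 'n) monoid_scheme \<Rightarrow> bool" where
  "embeds G H \<longleftrightarrow> mon G H \<noteq> {}"

(* Every finite group is isomorphic to one whose carrier is a set of natural numbers. *)
definition F_universal :: "('a, 'm) monoid_scheme \<Rightarrow> bool" where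
  "F_universal G \<longleftrightarrow> (\<forall>H :: nat monoid. group H \<and> finite (carrier H) \<longrightarrow> embeds H G)"

end

theory Submission
  imports Defs "HOL-Combinatorics.Cycles" "HOL-Library.Countable_Set_Type"
begin

text \<open>
  Let \<open>c\<close> assign a set of primes to each pair from a set \<open>V\<close>. In a torsion-free nilpotent group of class
  2 generated by the roots of infinitely 2-divisible elements \<open>a v\<close> and infinitely 3-divisible elements
  \<open>b w\<close>, let the commutator of \<open>b w\<close> and \<open>a v\<close> be
  infinitely divisible by exactly 2, 3 and the primes in \<open>c w v\<close>. Embeddings preserve infinite
  divisibility, and in a tensor product nothing cancels, so an embedding of such groups yields maps
  \<open>g, h\<close> of the index sets with \<open>c w v \<subseteq> c' (h w) (g v)\<close>. A direct factor consisting of the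
  finitary permutations of the natural numbers is torsion, does not interfere with this, and makes the
  group F-universal.

  Every set carries a labelling admitting only the identity as label-preserving self-map. For
  \<open>\<kappa> \<in> K\<close> and \<open>P \<subseteq> \<kappa>\<close> take the rigid labelling of \<open>\<kappa>\<close> with \<open>P\<close> marked, which separates the \<open>2\<^sup>\<kappa>\<close>
  groups of order \<open>\<kappa>\<close>, together with a rigidly labelled set of size \<open>b i \<le> \<kappa>\<close>, \<open>i < \<omega>\<^sub>1\<close>, and a marked
  subset of it. As \<open>|K| = sup 2^b i\<close>, no more than \<open>2^b i\<close> members of \<open>K\<close> need the same level \<open>i\<close>, so the
  marked subsets separate these. Finally, there are at most \<open>2^\<aleph>\<^sub>0\<close> levels, so a subset of the natural
  numbers, written into the labels, separates different levels.
\<close>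

section \<open>Rigid labellings\<close>

text \<open>In an arbitrary well-order of the type, \<open>t\<close> is moved to the end: pairs are
  compared first by whether they are \<open>t\<close>. The last element makes every increasing
  sequence bounded.\<close>

lemma exists_wf_total_with_top:
  fixes t :: 'x
  obtains L :: "'x rel" where "wf L" "trans L" "total L" "\<And>x. x \<noteq> t \<Longrightarrow> (x, t) \<in> L"
proof -
  obtain r :: "'x rel" where r: "well_order_on UNIV r"
    using well_order_on by blast
  let ?s = "r - Id"
  let ?L = "inv_image (less_than <*lex*> ?s) (\<lambda>x. (of_bool (x = t) :: nat, x))"
  have w: "wf ?s" "trans r" "total r" "antisym r"
    using r by (auto simp: well_order_on_def linear_order_on_def partial_order_on_def preorder_on_def)
  have "trans ?s" using w(2,4) trans_diff_Id by blast
  moreover have "total ?s" using w(3) by auto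
  ultimately have "wf ?L" "trans ?L" "total ?L"
    using w(1) by (auto intro: wf_inv_image wf_lex_prod trans_inv_image trans_lex_prod) (auto simp: total_on_def)
  moreover have "(x, t) \<in> ?L" if "x \<noteq> t" for x using that by auto
  ultimately show thesis by (rule that)
qed

text \<open>Only distinct arguments are compared, because the diagonal is kept free for the bits of
  \<open>marked_labels\<close>. The map \<open>g\<close> may be any self-map, injective or
  not.\<close>

definition rigid :: "'x set \<Rightarrow> ('x \<Rightarrow> 'x \<Rightarrow> 'l set) \<Rightarrow> bool" where
  "rigid V s \<longleftrightarrow> (\<forall>g \<in> V \<rightarrow> V. (\<forall>x\<in>V. \<forall>y\<in>V. x \<noteq> y \<longrightarrow> s x y \<subseteq> s (g x) (g y)) \<longrightarrow> (\<forall>x\<in>V. g x = x))"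

text \<open>Label 0 says that \<open>x\<close> precedes \<open>y\<close> in a well-order of \<open>V\<close> with a last element, and label \<open>n + 1\<close> that
  \<open>x\<close> is the \<open>n\<close>-th member of a fixed \<open>\<omega>\<close>-sequence converging to \<open>y\<close>. A label-preserving \<open>g\<close> is strictly
  increasing; if it moves \<open>x\<close>, it fixes the limit of \<open>x, g x, g (g x), \<dots>\<close>, hence also the
  fixed sequence converging to that limit, which is impossible.\<close>
lemma exists_rigid:
  fixes V :: "'x set"
  shows "\<exists>s :: 'x \<Rightarrow> 'x \<Rightarrow> nat set. rigid V s"
proof (cases "V = {}")
  case False
  obtain t where t: "t \<in> V" using False by blast
  obtain L :: "'x rel" where L: "wf L" "trans L" "total L" and top: "\<And>x. x \<noteq> t \<Longrightarrow> (x, t) \<in> L"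
    using exists_wf_total_with_top[where t = t] by blast
  have irr: "(x, x) \<notin> L" for x using L(1) by auto
  have tr: "(x, y) \<in> L \<Longrightarrow> (y, z) \<in> L \<Longrightarrow> (x, z) \<in> L" for x y z using transD[OF L(2)] by blast
  have tot: "(x, y) \<in> L \<or> x = y \<or> (y, x) \<in> L" for x y using L(3) by (auto simp: total_on_def)
  \<comment> \<open>\<open>conv \<eta> \<delta>\<close>: the sequence \<eta> lies below \<delta> in
    \<open>V\<close> and is cofinal there.\<close>
  define conv where "conv \<eta> \<delta> \<longleftrightarrow> (\<forall>n::nat. \<eta> n \<in> V \<and> (\<eta> n, \<delta>) \<in> L) \<and> (\<forall>x\<in>V. (x, \<delta>) \<in> L \<longrightarrow> (\<exists>n. (x, \<eta> n) \<in> L))"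
    for \<eta> and \<delta> :: 'x
  define lad where "lad \<delta> = (SOME \<eta>. conv \<eta> \<delta>)" for \<delta>
  have lad: "conv (lad \<delta>) \<delta>" if "conv \<eta> \<delta>" for \<eta> \<delta>
    unfolding lad_def by (rule someI[where P = "\<lambda>\<eta>. conv \<eta> \<delta>", OF that])
  define s where "s x y = {n. (x, y) \<in> L \<and> (case n of 0 \<Rightarrow> True | Suc m \<Rightarrow> conv (lad y) y \<and> x = lad y m)}" for x y
  have "rigid V s"
    unfolding rigid_def
  proof (intro ballI impI)
    fix g x
    assume gV: "g \<in> V \<rightarrow> V" and "\<forall>x\<in>V. \<forall>y\<in>V. x \<noteq> y \<longrightarrow> s x y \<subseteq> s (g x) (g y)" and "x \<in> V"
    then have hom: "\<And>x y. \<lbrakk>x \<in> V; y \<in> V; x \<noteq> y\<rbrakk> \<Longrightarrow> s x y \<subseteq> s (g x) (g y)" by blast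
    have mono: "(g x, g y) \<in> L" if "x \<in> V" "y \<in> V" "(x, y) \<in> L" for x y
    proof -
      have "0 \<in> s x y" using that by (simp add: s_def)
      moreover have "x \<noteq> y" using that irr by auto
      ultimately have "0 \<in> s (g x) (g y)" using hom that by blast
      then show ?thesis by (simp add: s_def)
    qed
    have ladhom: "conv (lad (g \<delta>)) (g \<delta>) \<and> g (lad \<delta> n) = lad (g \<delta>) n" if "\<delta> \<in> V" "conv (lad \<delta>) \<delta>" for \<delta> n
    proof -
      have "lad \<delta> n \<in> V" "(lad \<delta> n, \<delta>) \<in> L" using that by (auto simp: conv_def)
      then have "Suc n \<in> s (lad \<delta> n) \<delta>" "lad \<delta> n \<noteq> \<delta>" using that irr by (auto simp: s_def)
      then have "Suc n \<in> s (g (lad \<delta> n)) (g \<delta>)" using hom \<open>lad \<delta> n \<in> V\<close> that by blast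
      then show ?thesis by (simp add: s_def)
    qed
    \<comment> \<open>If \<open>g x\<close> were below \<open>x\<close>, monotonicity would put
      \<open>g (g x)\<close> below \<open>g x\<close>, giving a smaller counterexample.\<close>
    have nodesc: "(g x, x) \<notin> L" if "x \<in> V" for x
      using L(1) that
    proof (induction x rule: wf_induct_rule)
      case (less x)
      show ?case
      proof
        assume a: "(g x, x) \<in> L"
        have "g x \<in> V" using funcset_mem[OF gV] less.prems by blast
        then have "(g (g x), g x) \<in> L" by (rule mono[OF _ less.prems a])
        with less.IH[OF a \<open>g x \<in> V\<close>] show False by blast
      qed
    qed
    show "g x = x"
    proof (rule ccontr)
      assume "g x \<noteq> x"
      define \<xi> where "\<xi> n = (g ^^ n) x" for n
      have \<xi>V: "\<xi> n \<in> V" for n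
        by (induction n) (use funcset_mem[OF gV] \<open>x \<in> V\<close> in \<open>auto simp: \<xi>_def\<close>)
      have \<xi>S: "\<xi> (Suc n) = g (\<xi> n)" for n by (simp add: \<xi>_def)
      have inc: "(\<xi> n, \<xi> (Suc n)) \<in> L" for n
      proof (induction n)
        case 0
        then show ?case using nodesc[OF \<open>x \<in> V\<close>] tot[of x "g x"] \<open>g x \<noteq> x\<close> by (auto simp: \<xi>_def)
      next
        case (Suc n)
        then show ?case using mono[OF \<xi>V \<xi>V Suc] by (simp add: \<xi>S)
      qed
      \<comment> \<open>The upper bounds of the orbit of \<open>x\<close>. The last element
        \<open>t\<close> is one of them, and the least one is the limit \<delta>.\<close>
      let ?U = "{y \<in> V. \<forall>n. (\<xi> n, y) \<in> L}"
      have "t \<in> ?U"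
      proof -
        have "(\<xi> n, t) \<in> L" for n
        proof (cases "\<xi> n = t")
          case True
          then have "\<xi> (Suc n) \<noteq> t" using inc[of n] irr by metis
          then show ?thesis using inc[of n] top tr by blast
        qed (use top in auto)
        with t show ?thesis by blast
      qed
      then obtain \<delta> where \<delta>: "\<delta> \<in> ?U" "\<And>y. (y, \<delta>) \<in> L \<Longrightarrow> y \<notin> ?U"
        by (rule wfE_min[OF L(1)]) (rule that)
      have "conv \<xi> \<delta>"
        unfolding conv_def
      proof (intro conjI allI ballI impI)
        fix y assume "y \<in> V" "(y, \<delta>) \<in> L"
        with \<delta>(2) obtain n where "(\<xi> n, y) \<notin> L" by blast
        then have "(y, \<xi> (Suc n)) \<in> L" using tot[of "\<xi> n" y] inc[of n] tr[of y "\<xi> n" "\<xi> (Suc n)"] by auto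
        then show "\<exists>n. (y, \<xi> n) \<in> L" by blast
      qed (use \<delta> \<xi>V in auto)
      have cov: "\<exists>m. (y, \<xi> m) \<in> L" if "y \<in> V" "(y, \<delta>) \<in> L" for y
        using \<open>conv \<xi> \<delta>\<close> that unfolding conv_def by blast
      from \<open>conv \<xi> \<delta>\<close> have c: "conv (lad \<delta>) \<delta>" by (rule lad)
      have \<delta>V: "\<delta> \<in> V" using \<delta> by blast
      have le: "(lad \<delta> n, \<delta>) \<in> L" "lad \<delta> n \<in> V" for n using c by (auto simp: conv_def)
      \<comment> \<open>Otherwise the ladder of \<open>g \<delta>\<close> passes \<delta> at some
        \<open>n\<close>. But that ladder is the image of the ladder of \<delta>, whose
        \<open>n\<close>-th member lies below some \<open>\<xi> m\<close>, so its image lies below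
        \<open>\<xi> (Suc m)\<close> and hence below \<delta>.\<close>
      have "(\<delta>, g \<delta>) \<notin> L"
      proof
        assume "(\<delta>, g \<delta>) \<in> L"
        moreover have "conv (lad (g \<delta>)) (g \<delta>)" using ladhom[OF \<delta>V c] by blast
        ultimately obtain n where n: "(\<delta>, lad (g \<delta>) n) \<in> L"
          using \<delta>V unfolding conv_def by blast
        obtain m where "(lad \<delta> n, \<xi> m) \<in> L" using cov le by blast
        then have "(g (lad \<delta> n), \<xi> (Suc m)) \<in> L" using mono[OF le(2) \<xi>V] by (simp add: \<xi>S)
        moreover have "(\<delta>, g (lad \<delta> n)) \<in> L" using n ladhom[OF \<delta>V c] by simp
        ultimately have "(\<delta>, \<xi> (Suc m)) \<in> L" using tr by blast
        moreover have "(\<xi> (Suc m), \<delta>) \<in> L" using \<delta>(1) by blast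
        ultimately show False using tr[of \<delta> "\<xi> (Suc m)" \<delta>] irr by simp
      qed
      then have fix\<delta>: "g \<delta> = \<delta>" using nodesc[OF \<delta>V] tot by blast
      \<comment> \<open>A ladder member above \<open>x\<close> is fixed by \<open>g\<close>, so by
        monotonicity it stays above the whole orbit, although the orbit is cofinal below
        \<delta>.\<close>
      obtain n where n: "(\<xi> 0, lad \<delta> n) \<in> L" using c \<delta>(1) \<xi>V[of 0] unfolding conv_def by auto
      have fixl: "g (lad \<delta> n) = lad \<delta> n" using ladhom[OF \<delta>V c] fix\<delta> by simp
      have "(\<xi> m, lad \<delta> n) \<in> L" for m
      proof (induction m)
        case (Suc m)
        then have "(g (\<xi> m), g (lad \<delta> n)) \<in> L" by (intro mono le \<xi>V)
        then show ?case by (simp add: \<xi>S fixl)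
      qed (rule n)
      moreover have "\<exists>m. (lad \<delta> n, \<xi> m) \<in> L" by (rule cov[OF le(2,1)])
      ultimately obtain m where "(lad \<delta> n, \<xi> m) \<in> L" "(\<xi> m, lad \<delta> n) \<in> L" by blast
      then show False using tr[of "lad \<delta> n" "\<xi> m" "lad \<delta> n"] irr by simp
    qed
  qed
  then show ?thesis by blast
qed (simp add: rigid_def)


section \<open>Groups from labelled sets\<close>

definition localization :: "nat set \<Rightarrow> rat set" where
  "localization S = {of_int m / of_nat n | m n. n > 0 \<and> (\<forall>p. Factorial_Ring.prime p \<and> p dvd n \<longrightarrow> p \<in> S)}"

lemma localization_divide:
  assumes "n > 0" "\<And>p. Factorial_Ring.prime p \<Longrightarrow> p dvd n \<Longrightarrow> p \<in> S"
  shows "of_int m / of_nat n \<in> localization S"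
  using assms unfolding localization_def by blast

lemma of_int_in_localization [simp]: "of_int m \<in> localization S"
  using localization_divide[of 1 S m] by simp

lemma zero_in_localization [simp]: "0 \<in> localization S"
  using of_int_in_localization[of 0] by simp

lemma localization_uminus [simp]: "x \<in> localization S \<Longrightarrow> - x \<in> localization S"
  unfolding localization_def by clarsimp (metis minus_divide_left of_int_minus)

lemma localization_add:
  assumes "x \<in> localization S" "y \<in> localization S"
  shows "x + y \<in> localization S"
proof -
  obtain m n m' n' where x: "x = of_int m / of_nat n" "n > 0" "\<And>p. Factorial_Ring.prime p \<Longrightarrow> p dvd n \<Longrightarrow> p \<in> S"
    and y: "y = of_int m' / of_nat n'" "n' > 0" "\<And>p. Factorial_Ring.prime p \<Longrightarrow> p dvd n' \<Longrightarrow> p \<in> S"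
    using assms unfolding localization_def by blast
  have "x + y = of_int (m * int n' + m' * int n) / of_nat (n * n')"
    using x(1,2) y(1,2) by (simp add: field_simps)
  moreover have "of_int (m * int n' + m' * int n) / of_nat (n * n') \<in> localization S"
    using x y by (intro localization_divide) (auto simp: prime_dvd_mult_iff)
  ultimately show ?thesis by simp
qed

lemma localization_mult:
  assumes "x \<in> localization S" "y \<in> localization S"
  shows "x * y \<in> localization S"
proof -
  obtain m n m' n' where x: "x = of_int m / of_nat n" "n > 0" "\<And>p. Factorial_Ring.prime p \<Longrightarrow> p dvd n \<Longrightarrow> p \<in> S"
    and y: "y = of_int m' / of_nat n'" "n' > 0" "\<And>p. Factorial_Ring.prime p \<Longrightarrow> p dvd n' \<Longrightarrow> p \<in> S"
    using assms unfolding localization_def by blast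
  have "x * y = of_int (m * m') / of_nat (n * n')"
    using x(1) y(1) by simp
  moreover have "of_int (m * m') / of_nat (n * n') \<in> localization S"
    using x y by (intro localization_divide) (auto simp: prime_dvd_mult_iff)
  ultimately show ?thesis by simp
qed

lemma localization_diff:
  assumes "x \<in> localization S" "y \<in> localization S"
  shows "x - y \<in> localization S"
  using localization_add[of x S "- y"] assms by simp

lemma localization_mono: "S \<subseteq> T \<Longrightarrow> localization S \<subseteq> localization T"
  unfolding localization_def by blast

lemma inverse_power_in_localization:
  assumes "Factorial_Ring.prime p" "p \<in> S"
  shows "1 / of_nat p ^ k \<in> localization S"
proof -
  have "of_int 1 / of_nat (p ^ k) \<in> localization S"
  proof (rule localization_divide)
    show "q \<in> S" if "Factorial_Ring.prime q" "q dvd p ^ k" for q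
      using prime_dvd_power[OF that] primes_dvd_imp_eq[OF that(1) assms(1)] assms(2) by blast
  qed (use assms(1) in \<open>simp add: prime_gt_0_nat\<close>)
  then show ?thesis by simp
qed

text \<open>Denominators of elements of the localization are prime to \<open>p\<close>, so every
  power of \<open>p\<close> would have to divide the numerator of \<open>x\<close>.\<close>

lemma localization_divisible:
  assumes p: "Factorial_Ring.prime p" "p \<notin> S" and div: "\<And>k. \<exists>y\<in>localization S. x = of_nat p ^ k * y"
  shows "x = 0"
proof (rule ccontr)
  assume "x \<noteq> 0"
  obtain m n where x: "x = of_int m / of_nat n" "n > 0"
    using div[of 0] unfolding localization_def by auto
  have m0: "m \<noteq> 0" using \<open>x \<noteq> 0\<close> x by simp
  \<comment> \<open>With this exponent |m| < 2^k \<le> p^k, so p^k cannot divide the nonzero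
    \<open>m\<close>.\<close>
  define k where "k = nat \<bar>m\<bar>"
  obtain m' n' where y: "x = of_nat p ^ k * (of_int m' / of_nat n')" "n' > 0" and n': "\<not> p dvd n'"
    using div[of k] p unfolding localization_def by blast
  have "of_int m * (of_nat n' :: rat) = of_nat p ^ k * of_int m' * of_nat n"
    using x y by (simp add: field_simps)
  then have "(of_int (m * int n') :: rat) = of_int (int p ^ k * (m' * int n))"
    by (simp add: mult.assoc)
  then have "m * int n' = int p ^ k * (m' * int n)" by (simp only: of_int_eq_iff)
  then have "int p ^ k dvd m * int n'" by simp
  moreover have "coprime (int p ^ k) (int n')"
    using p(1) n' by (metis coprime_int_iff coprime_power_left_iff prime_imp_coprime of_nat_power)
  ultimately have "int p ^ k dvd m" by (simp add: coprime_dvd_mult_left_iff)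
  then have "int p ^ k \<le> \<bar>m\<bar>" using m0 by (metis abs_of_nonneg dvd_imp_le_int of_nat_0_le_iff of_nat_power)
  moreover have "\<bar>m\<bar> < int p ^ k"
  proof -
    have "k < 2 ^ k" by (rule less_exp)
    also have "(2::nat) ^ k \<le> p ^ k" using p(1) by (simp add: power_mono prime_ge_2_nat)
    finally have "int k < int (p ^ k)" by linarith
    then show ?thesis by (simp add: k_def)
  qed
  ultimately show False by simp
qed

section \<open>A Heisenberg group with entries from localizations\<close>

type_synonym 'x heis = "('x \<Rightarrow> rat) \<times> ('x \<Rightarrow> rat) \<times> ('x \<times> 'x \<Rightarrow> rat)"

definition fin_supp :: "'x set \<Rightarrow> ('x \<Rightarrow> 'b::zero) \<Rightarrow> bool" where
  "fin_supp V f \<longleftrightarrow> finite {x. f x \<noteq> 0} \<and> {x. f x \<noteq> 0} \<subseteq> V"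

text \<open>Upper unitriangular \<open>3 \<times> 3\<close> matrices with the product of the entries \<open>b\<close> and \<open>a\<close> replaced by a
  tensor product, so that the commutators of different pairs of generators are linearly independent.
  The primes 2 and 3 mark the two layers of generators.\<close>
definition heis :: "'x set \<Rightarrow> ('x \<Rightarrow> 'x \<Rightarrow> nat set) \<Rightarrow> 'x heis monoid" where
  "heis V c =
    \<lparr>carrier = {(a, b, z). fin_supp V a \<and> fin_supp V b \<and> fin_supp (V \<times> V) z \<and>
        (\<forall>v. a v \<in> localization {2}) \<and> (\<forall>w. b w \<in> localization {3}) \<and>
        (\<forall>w v. z (w, v) \<in> localization ({2, 3} \<union> c w v))},
     monoid.mult = (\<lambda>(a, b, z) (a', b', z').
        (\<lambda>v. a v + a' v, \<lambda>w. b w + b' w, \<lambda>(w, v). z (w, v) + z' (w, v) + b w * a' v)),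
     one = (\<lambda>_. 0, \<lambda>_. 0, \<lambda>_. 0)\<rparr>"

lemma fin_supp_zero [simp]: "fin_supp V (\<lambda>_. 0)" by (simp add: fin_supp_def)

lemma fin_supp_add:
  fixes f g :: "'x \<Rightarrow> 'b::comm_monoid_add"
  assumes "fin_supp V f" "fin_supp V g" shows "fin_supp V (\<lambda>x. f x + g x)"
proof -
  have "{x. f x + g x \<noteq> 0} \<subseteq> {x. f x \<noteq> 0} \<union> {x. g x \<noteq> 0}" by auto
  then show ?thesis using assms unfolding fin_supp_def
    by (meson finite_UnI finite_subset le_sup_iff order_trans)
qed

lemma fin_supp_uminus:
  fixes f :: "'x \<Rightarrow> 'b::group_add"
  shows "fin_supp V f \<Longrightarrow> fin_supp V (\<lambda>x. - f x)"
  by (simp add: fin_supp_def)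

lemma fin_supp_diff:
  fixes f g :: "'x \<Rightarrow> 'b::ab_group_add"
  assumes "fin_supp V f" "fin_supp V g" shows "fin_supp V (\<lambda>x. f x - g x)"
  using fin_supp_add[OF assms(1) fin_supp_uminus[OF assms(2)]] by simp

lemma fin_supp_tensor:
  fixes b a :: "'x \<Rightarrow> rat"
  assumes "fin_supp V b" "fin_supp V a" shows "fin_supp (V \<times> V) (\<lambda>(w, v). b w * a v)"
proof -
  have "{x. (\<lambda>(w, v). b w * a v) x \<noteq> 0} \<subseteq> {x. b x \<noteq> 0} \<times> {x. a x \<noteq> 0}" by auto
  then show ?thesis using assms unfolding fin_supp_def
    by (meson finite_SigmaI finite_subset Sigma_mono order_trans)
qed

lemma tensor_in_localization:
  assumes "x \<in> localization {3}" "y \<in> localization {2}"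
  shows "x * y \<in> localization (insert 2 (insert 3 S))"
  using assms localization_mono[of "{3}" "insert 2 (insert 3 S)"] localization_mono[of "{2}" "insert 2 (insert 3 S)"]
  by (intro localization_mult) auto

lemma heis_mult_simp [simp]:
  "(a, b, z) \<otimes>\<^bsub>heis V c\<^esub> (a', b', z') =
    (\<lambda>v. a v + a' v, \<lambda>w. b w + b' w, \<lambda>(w, v). z (w, v) + z' (w, v) + b w * a' v)"
  by (simp add: heis_def)

lemma heis_one_simp [simp]: "\<one>\<^bsub>heis V c\<^esub> = (\<lambda>_. 0, \<lambda>_. 0, \<lambda>_. 0)"
  by (simp add: heis_def)

lemma heis_carrier: "(a, b, z) \<in> carrier (heis V c) \<longleftrightarrow>
  fin_supp V a \<and> fin_supp V b \<and> fin_supp (V \<times> V) z \<and>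
        (\<forall>v. a v \<in> localization {2}) \<and> (\<forall>w. b w \<in> localization {3}) \<and>
        (\<forall>w v. z (w, v) \<in> localization ({2, 3} \<union> c w v))"
  by (simp add: heis_def)

lemma group_heis: "group (heis V c)"
proof (rule groupI)
  fix x y assume "x \<in> carrier (heis V c)" "y \<in> carrier (heis V c)"
  moreover obtain a b z where x: "x = (a, b, z)" by (cases x)
  moreover obtain a' b' z' where y: "y = (a', b', z')" by (cases y)
  moreover have "(\<lambda>(w, v). z (w, v) + z' (w, v) + b w * a' v) = (\<lambda>q. (z q + z' q) + (\<lambda>(w, v). b w * a' v) q)"
    by auto
  ultimately show "x \<otimes>\<^bsub>heis V c\<^esub> y \<in> carrier (heis V c)"
    by (auto simp: heis_carrier intro!: fin_supp_add fin_supp_tensor localization_add tensor_in_localization)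
next
  fix x assume "x \<in> carrier (heis V c)"
  moreover obtain a b z where x: "x = (a, b, z)" by (cases x)
  \<comment> \<open>The summand \<open>b w * a v\<close> of the inverse cancels the mixed term that
    arises in the product.\<close>
  let ?y = "(\<lambda>v. - a v, \<lambda>w. - b w, \<lambda>q. (\<lambda>(w, v). b w * a v) q - z q)"
  from calculation x have "?y \<in> carrier (heis V c)" "?y \<otimes>\<^bsub>heis V c\<^esub> x = \<one>\<^bsub>heis V c\<^esub>"
    by (auto simp: heis_carrier intro!: fin_supp_diff fin_supp_uminus fin_supp_tensor localization_diff tensor_in_localization)
  then show "\<exists>y\<in>carrier (heis V c). y \<otimes>\<^bsub>heis V c\<^esub> x = \<one>\<^bsub>heis V c\<^esub>" by blast
qed (auto simp: heis_carrier algebra_simps)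

lemma heis_nat_pow_fst: "fst (x [^]\<^bsub>heis V c\<^esub> (n::nat)) = (\<lambda>v. of_nat n * fst x v)"
proof (induction n)
  case (Suc n)
  then show ?case
    by (cases x; cases "x [^]\<^bsub>heis V c\<^esub> n") (auto simp: algebra_simps monoid.nat_pow_Suc[OF group.is_monoid[OF group_heis]])
qed simp

lemma heis_nat_pow_fst_snd: "fst (snd (x [^]\<^bsub>heis V c\<^esub> (n::nat))) = (\<lambda>v. of_nat n * fst (snd x) v)"
proof (induction n)
  case (Suc n)
  then show ?case
    by (cases x; cases "x [^]\<^bsub>heis V c\<^esub> n") (auto simp: algebra_simps)
qed simp

lemma heis_nat_pow_centre: "(\<lambda>_. 0, \<lambda>_. 0, z) [^]\<^bsub>heis V c\<^esub> (n::nat) = (\<lambda>_. 0, \<lambda>_. 0, \<lambda>q. of_nat n * z q)"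
  by (induction n) (auto simp: algebra_simps)

definition unit_fun :: "'x \<Rightarrow> 'x \<Rightarrow> rat" where
  "unit_fun x y = of_bool (y = x)"

lemma fin_supp_unit_fun: "x \<in> V \<Longrightarrow> fin_supp V (\<lambda>y. r * unit_fun x y)"
  by (auto simp: fin_supp_def unit_fun_def intro: finite_subset[of _ "{x}"])

lemma unit_fun_in_localization:
  assumes "Factorial_Ring.prime p" "p \<in> S"
  shows "1 / of_nat p ^ k * unit_fun x y \<in> localization S"
  using inverse_power_in_localization[OF assms] by (simp add: unit_fun_def)

section \<open>Infinitely divisible elements and homomorphisms between Heisenberg groups\<close>

definition divisible_elt :: "('g, 'm) monoid_scheme \<Rightarrow> nat \<Rightarrow> 'g \<Rightarrow> bool" where
  "divisible_elt G p x \<longleftrightarrow> (\<forall>k::nat. \<exists>y\<in>carrier G. y [^]\<^bsub>G\<^esub> (p ^ k) = x)"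

lemma divisible_elt_hom:
  assumes "f \<in> hom G H" "group G" "group H" "divisible_elt G p x"
  shows "divisible_elt H p (f x)"
  unfolding divisible_elt_def
proof
  fix k :: nat
  interpret group_hom G H f using assms by (simp add: group_hom_def group_hom_axioms_def)
  obtain y where "y \<in> carrier G" "y [^]\<^bsub>G\<^esub> (p ^ k) = x"
    using assms(4) unfolding divisible_elt_def by blast
  then show "\<exists>y\<in>carrier H. y [^]\<^bsub>H\<^esub> (p ^ k) = f x"
    using hom_nat_pow by (intro bexI[of _ "f y"]) auto
qed

text \<open>The first coordinate is additive with values in Z[1/2], where 0 alone is divisible by
  all powers of a prime other than 2.\<close>

lemma heis_divisible_fst:
  assumes "divisible_elt (heis V c) p (a, b, z)" "Factorial_Ring.prime p" "p \<noteq> 2"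
  shows "a = (\<lambda>_. 0)"
proof
  fix v
  have "\<exists>y\<in>localization {2}. a v = of_nat p ^ k * y" for k
  proof -
    obtain a' b' z' where y: "(a', b', z') \<in> carrier (heis V c)" "(a', b', z') [^]\<^bsub>heis V c\<^esub> (p ^ k) = (a, b, z)"
      using assms(1) unfolding divisible_elt_def by (metis prod_cases3)
    show ?thesis
      using y heis_nat_pow_fst[of V c "(a', b', z')" "p ^ k"] by (intro bexI[of _ "a' v"]) (auto simp: heis_carrier)
  qed
  then show "a v = 0" by (rule localization_divisible[rotated 2]) (use assms in auto)
qed

lemma heis_divisible_fst_snd:
  assumes "divisible_elt (heis V c) p (a, b, z)" "Factorial_Ring.prime p" "p \<noteq> 3"
  shows "b = (\<lambda>_. 0)"
proof
  fix v
  have "\<exists>y\<in>localization {3}. b v = of_nat p ^ k * y" for k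
  proof -
    obtain a' b' z' where y: "(a', b', z') \<in> carrier (heis V c)" "(a', b', z') [^]\<^bsub>heis V c\<^esub> (p ^ k) = (a, b, z)"
      using assms(1) unfolding divisible_elt_def by (metis prod_cases3)
    show ?thesis
      using y heis_nat_pow_fst_snd[of V c "(a', b', z')" "p ^ k"] by (intro bexI[of _ "b' v"]) (auto simp: heis_carrier)
  qed
  then show "b v = 0" by (rule localization_divisible[rotated 2]) (use assms in auto)
qed

text \<open>As \<open>p\<close> is neither 2 nor 3, the first two coordinates vanish, for the
  element and thus for its roots. Powers of such roots act coordinatewise on \<open>z\<close>, so
  the divisibility takes place inside the localization belonging to (w, v).\<close>

lemma heis_divisible_snd_snd:
  assumes "divisible_elt (heis V c) p (a, b, z)" "Factorial_Ring.prime p" "p \<notin> {2, 3}" "z (w, v) \<noteq> 0"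
  shows "p \<in> c w v"
proof (rule ccontr)
  assume np: "p \<notin> c w v"
  have p0: "p > 0" using assms(2) by (simp add: prime_gt_0_nat)
  have ab: "a = (\<lambda>_. 0)" "b = (\<lambda>_. 0)"
    using heis_divisible_fst heis_divisible_fst_snd assms by blast+
  have "\<exists>y\<in>localization ({2, 3} \<union> c w v). z (w, v) = of_nat p ^ k * y" for k
  proof -
    obtain a' b' z' where y: "(a', b', z') \<in> carrier (heis V c)" "(a', b', z') [^]\<^bsub>heis V c\<^esub> (p ^ k) = (a, b, z)"
      using assms(1) unfolding divisible_elt_def by (metis prod_cases3)
    have "a' = (\<lambda>_. 0)" "b' = (\<lambda>_. 0)"
      using y ab p0 heis_nat_pow_fst[of V c "(a', b', z')" "p ^ k"] heis_nat_pow_fst_snd[of V c "(a', b', z')" "p ^ k"]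
      by (auto simp: fun_eq_iff)
    with y have "z = (\<lambda>q. of_nat (p ^ k) * z' q)" by (simp add: heis_nat_pow_centre)
    with y show ?thesis by (intro bexI[of _ "z' (w, v)"]) (auto simp: heis_carrier)
  qed
  then have "z (w, v) = 0" by (rule localization_divisible[rotated 2]) (use assms np in auto)
  with assms(4) show False by simp
qed

text \<open>The commutator of the 3-divisible generator at \<open>w\<close> and the 2-divisible
  generator at \<open>v\<close>; it is nontrivial even for w = v.\<close>

definition heis_comm :: "'x \<Rightarrow> 'x \<Rightarrow> 'x heis" where
  "heis_comm w v = (\<lambda>_. 0, \<lambda>_. 0, unit_fun (w, v))"

lemma heis_comm_carrier:
  assumes "w \<in> V" "v \<in> V" shows "heis_comm w v \<in> carrier (heis V c)"
  using assms fin_supp_unit_fun[of "(w, v)" "V \<times> V" 1]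
  by (auto simp: heis_comm_def heis_carrier) (auto simp: unit_fun_def of_int_in_localization[of 1, simplified])

lemma heis_divisible_comm:
  assumes "w \<in> V" "v \<in> V" "Factorial_Ring.prime p" "p \<in> {2, 3} \<union> c w v"
  shows "divisible_elt (heis V c) p (heis_comm w v)"
  unfolding divisible_elt_def
proof
  fix k :: nat
  let ?y = "(\<lambda>_. 0, \<lambda>_. 0, \<lambda>q. 1 / of_nat p ^ k * unit_fun (w, v) q)"
  have "p > 0" using assms(3) by (simp add: prime_gt_0_nat)
  then have "?y [^]\<^bsub>heis V c\<^esub> (p ^ k) = heis_comm w v"
    by (simp add: heis_nat_pow_centre heis_comm_def)
  moreover have "1 / of_nat p ^ k * unit_fun (w, v) (w', v') \<in> localization ({2, 3} \<union> c w' v')" for w' v'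
  proof (cases "(w', v') = (w, v)")
    case True
    then show ?thesis
      using unit_fun_in_localization[OF assms(3,4), of k "(w, v)" "(w', v')"] by simp
  qed (auto simp: unit_fun_def)
  then have "?y \<in> carrier (heis V c)"
    using fin_supp_unit_fun[of "(w, v)" "V \<times> V" "1 / of_nat p ^ k"] assms(1,2) by (simp add: heis_carrier)
  ultimately show "\<exists>y\<in>carrier (heis V c). y [^]\<^bsub>heis V c\<^esub> (p ^ k) = heis_comm w v" by blast
qed

lemma heis_divisible_gens:
  assumes "v \<in> V"
  shows "divisible_elt (heis V c) 2 (unit_fun v, \<lambda>_. 0, \<lambda>_. 0)"
    and "divisible_elt (heis V c) 3 (\<lambda>_. 0, unit_fun v, \<lambda>_. 0)"
proof -
  let ?x = "\<lambda>k. (\<lambda>x. 1 / of_nat 2 ^ k * unit_fun v x, \<lambda>_. 0, \<lambda>_. 0) :: 'a heis"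
  let ?y = "\<lambda>k. (\<lambda>_. 0, \<lambda>x. 1 / of_nat 3 ^ k * unit_fun v x, \<lambda>_. 0) :: 'a heis"
  have "(a, \<lambda>_. 0, \<lambda>_. 0) [^]\<^bsub>heis V c\<^esub> n = (\<lambda>x. of_nat n * a x, \<lambda>_. 0, \<lambda>_. 0)"
    and "(\<lambda>_. 0, a, \<lambda>_. 0) [^]\<^bsub>heis V c\<^esub> n = (\<lambda>_. 0, \<lambda>x. of_nat n * a x, \<lambda>_. 0)" for a :: "'a \<Rightarrow> rat" and n :: nat
    by (induction n) (auto simp: algebra_simps)
  then have p: "?x k [^]\<^bsub>heis V c\<^esub> ((2::nat) ^ k) = (unit_fun v, \<lambda>_. 0, \<lambda>_. 0)"
     "?y k [^]\<^bsub>heis V c\<^esub> ((3::nat) ^ k) = (\<lambda>_. 0, unit_fun v, \<lambda>_. 0)" for k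
    by simp_all
  have "?x k \<in> carrier (heis V c)" "?y k \<in> carrier (heis V c)" for k
    using fin_supp_unit_fun[OF assms, of "1 / of_nat 2 ^ k"] fin_supp_unit_fun[OF assms, of "1 / of_nat 3 ^ k"]
      unit_fun_in_localization[of 2 "{2}" k v] unit_fun_in_localization[of 3 "{3}" k v]
    by (simp_all add: heis_carrier)
  with p show "divisible_elt (heis V c) 2 (unit_fun v, \<lambda>_. 0, \<lambda>_. 0)"
    "divisible_elt (heis V c) 3 (\<lambda>_. 0, unit_fun v, \<lambda>_. 0)"
    unfolding divisible_elt_def by blast+
qed

lemma divisible_elt_carrier: "group G \<Longrightarrow> divisible_elt G p x \<Longrightarrow> x \<in> carrier G"
  unfolding divisible_elt_def by (metis group.is_monoid monoid.nat_pow_closed)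

text \<open>Divisibility by 2 and 3 keeps the two layers of generators apart, modulo the centre, so
  the commutator of (w, v) goes to the tensor of \<beta> w and \<alpha> v. Both factors are nonzero;
  \<open>h w\<close> and \<open>g v\<close> are chosen in their supports. The tensor is then nonzero
  at (h w, g v), and each prime dividing the commutator infinitely must occur in the label
  there.\<close>

lemma heis_hom_labels:
  assumes \<phi>: "\<phi> \<in> hom (heis V c) (heis V' c')"
    and nontriv: "\<And>w v. w \<in> V \<Longrightarrow> v \<in> V \<Longrightarrow> \<phi> (heis_comm w v) \<noteq> \<one>\<^bsub>heis V' c'\<^esub>"
    and primes: "\<And>w v p. w \<in> V \<Longrightarrow> v \<in> V \<Longrightarrow> p \<in> c w v \<Longrightarrow> Factorial_Ring.prime p \<and> p \<notin> {2, 3}"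
  obtains g h where "g \<in> V \<rightarrow> V'" "h \<in> V \<rightarrow> V'" "\<And>w v. w \<in> V \<Longrightarrow> v \<in> V \<Longrightarrow> c w v \<subseteq> c' (h w) (g v)"
proof -
  let ?G = "heis V c" and ?H = "heis V' c'"
  let ?a = "\<lambda>v. (unit_fun v, \<lambda>_. 0, \<lambda>_. 0) :: 'a heis" and ?b = "\<lambda>w. (\<lambda>_. 0, unit_fun w, \<lambda>_. 0) :: 'a heis"
  define \<alpha> where "\<alpha> v = fst (\<phi> (?a v))" for v
  define \<beta> where "\<beta> w = fst (snd (\<phi> (?b w)))" for w
  note div = divisible_elt_hom[OF \<phi> group_heis group_heis]
  note car = divisible_elt_carrier[OF group_heis]
  have tensor: "\<phi> (heis_comm w v) = (\<lambda>_. 0, \<lambda>_. 0, \<lambda>(j, i). \<beta> w j * \<alpha> v i)" if "w \<in> V" "v \<in> V" for w v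
  proof -
    obtain b1 z1 where 1: "\<phi> (?a v) = (\<alpha> v, b1, z1)" by (metis \<alpha>_def prod.collapse)
    moreover have "b1 = (\<lambda>_. 0)"
      using heis_divisible_fst_snd div[OF heis_divisible_gens(1)] that 1 two_is_prime_nat by fastforce
    ultimately have a: "\<phi> (?a v) = (\<alpha> v, \<lambda>_. 0, z1)" by simp
    obtain a2 z2 where 2: "\<phi> (?b w) = (a2, \<beta> w, z2)" by (metis \<beta>_def prod.collapse)
    moreover have "a2 = (\<lambda>_. 0)"
      using heis_divisible_fst[of V' c' 3] div[OF heis_divisible_gens(2)] that 2 by fastforce
    ultimately have b: "\<phi> (?b w) = (\<lambda>_. 0, \<beta> w, z2)" by simp
    obtain a3 b3 \<zeta> where 3: "\<phi> (heis_comm w v) = (a3, b3, \<zeta>)" by (metis prod_cases3)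
    \<comment> \<open>The commutator is infinitely divisible by both 2 and 3, whatever its label: 3
      kills the first coordinate, 2 the second.\<close>
    have "divisible_elt ?H 3 (a3, b3, \<zeta>)" "divisible_elt ?H 2 (a3, b3, \<zeta>)"
      using div[OF heis_divisible_comm[OF that, of 3]] div[OF heis_divisible_comm[OF that, of 2]] 3 by simp_all
    then have "a3 = (\<lambda>_. 0)" "b3 = (\<lambda>_. 0)"
      by (auto dest: heis_divisible_fst heis_divisible_fst_snd)
    with 3 have c: "\<phi> (heis_comm w v) = (\<lambda>_. 0, \<lambda>_. 0, \<zeta>)" by simp
    \<comment> \<open>The relation b a = [b, a] a b is mapped by \<phi>. In the third coordinate
      \<open>z1\<close> and \<open>z2\<close> cancel, which determines \<zeta>.\<close>
    have "?b w \<otimes>\<^bsub>?G\<^esub> ?a v = heis_comm w v \<otimes>\<^bsub>?G\<^esub> (?a v \<otimes>\<^bsub>?G\<^esub> ?b w)"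
      by (auto simp: heis_comm_def unit_fun_def)
    moreover have "?b w \<in> carrier ?G" "?a v \<in> carrier ?G" "heis_comm w v \<in> carrier ?G"
      using car[OF heis_divisible_gens(2)[OF that(1)]] car[OF heis_divisible_gens(1)[OF that(2)]]
        heis_comm_carrier[OF that] by simp_all
    moreover from this have "?a v \<otimes>\<^bsub>?G\<^esub> ?b w \<in> carrier ?G"
      using monoid.m_closed[OF group.is_monoid[OF group_heis]] by blast
    ultimately have "\<phi> (?b w) \<otimes>\<^bsub>?H\<^esub> \<phi> (?a v) = \<phi> (heis_comm w v) \<otimes>\<^bsub>?H\<^esub> (\<phi> (?a v) \<otimes>\<^bsub>?H\<^esub> \<phi> (?b w))"
      using hom_mult[OF \<phi>] by metis
    then have "\<zeta> = (\<lambda>(j, i). \<beta> w j * \<alpha> v i)"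
      unfolding a b c by (auto simp: fun_eq_iff)
    with c show ?thesis by simp
  qed
  have "\<exists>i. \<alpha> v i \<noteq> 0" if "v \<in> V" for v
    using tensor[OF that that] nontriv[OF that that] by (auto simp: fun_eq_iff)
  then obtain g where g: "\<And>v. v \<in> V \<Longrightarrow> \<alpha> v (g v) \<noteq> 0" by metis
  have "\<exists>i. \<beta> v i \<noteq> 0" if "v \<in> V" for v
    using tensor[OF that that] nontriv[OF that that] by (auto simp: fun_eq_iff)
  then obtain h where h: "\<And>v. v \<in> V \<Longrightarrow> \<beta> v (h v) \<noteq> 0" by metis
  have "\<phi> (?a v) \<in> carrier ?H" "\<phi> (?b v) \<in> carrier ?H" if "v \<in> V" for v
    using car[OF div[OF heis_divisible_gens(1)[OF that]]] car[OF div[OF heis_divisible_gens(2)[OF that]]] by simp_all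
  then have "fin_supp V' (\<alpha> v)" "fin_supp V' (\<beta> v)" if "v \<in> V" for v
    unfolding \<alpha>_def \<beta>_def using that by (metis heis_carrier prod.collapse)+
  then have "g \<in> V \<rightarrow> V'" "h \<in> V \<rightarrow> V'" using g h unfolding fin_supp_def by blast+
  moreover have "c w v \<subseteq> c' (h w) (g v)" if wv: "w \<in> V" "v \<in> V" for w v
  proof
    fix p assume p: "p \<in> c w v"
    have "divisible_elt ?H p (\<phi> (heis_comm w v))"
      using wv p primes by (intro div heis_divisible_comm) auto
    then show "p \<in> c' (h w) (g v)"
      unfolding tensor[OF wv] by (rule heis_divisible_snd_snd) (use primes[OF wv p] g h wv in auto)
  qed
  ultimately show thesis by (rule that)
qed


section \<open>Adding finitary permutations\<close>

text \<open>The library predicate \<open>permutation\<close> means a product of finitely many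
  transpositions, equivalently a bijection of finite support.\<close>

definition fin_sym :: "(nat \<Rightarrow> nat) monoid" where
  "fin_sym = \<lparr>carrier = {f. permutation f}, monoid.mult = (\<circ>), one = id\<rparr>"

lemma fin_sym_simps [simp]:
  "f \<in> carrier fin_sym \<longleftrightarrow> permutation f" "f \<otimes>\<^bsub>fin_sym\<^esub> g = f \<circ> g" "\<one>\<^bsub>fin_sym\<^esub> = id"
  by (simp_all add: fin_sym_def)

lemma group_fin_sym: "group fin_sym"
proof (rule groupI)
  fix f assume "f \<in> carrier fin_sym"
  then show "\<exists>g\<in>carrier fin_sym. g \<otimes>\<^bsub>fin_sym\<^esub> f = \<one>\<^bsub>fin_sym\<^esub>"
    by (intro bexI[of _ "inv_into UNIV f"]) (auto simp: permutation_inverse permutation_inverse_works)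
qed (auto simp: permutation_compose permutation_id)

lemma fin_sym_torsion:
  assumes "f \<in> carrier fin_sym"
  obtains n :: nat where "n > 0" "f [^]\<^bsub>fin_sym\<^esub> n = \<one>\<^bsub>fin_sym\<^esub>"
proof -
  have "f [^]\<^bsub>fin_sym\<^esub> n = f ^^ n" for n :: nat
    by (induction n) (auto simp: funpow_swap1)
  moreover obtain n where "f ^^ n = id" "n > 0"
    using permutation_is_nilpotent assms by auto
  ultimately show thesis using that by simp
qed

text \<open>A finitary permutation is determined by the finite set of pairs (x, f x) with f x
  \<noteq> x, and there are only countably many finite sets of pairs of naturals.\<close>

lemma countable_fin_sym: "countable (carrier fin_sym)"
proof (rule countable_image_inj_on)
  let ?graph = "\<lambda>f :: nat \<Rightarrow> nat. {(x, f x) | x. f x \<noteq> x}"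
  have "finite (?graph f)" if "permutation f" for f
    using that by (auto simp: permutation intro: finite_surj[of "{x. f x \<noteq> x}" _ "\<lambda>x. (x, f x)"])
  then show "countable (?graph ` carrier fin_sym)"
    by (intro countable_subset[OF _ countable_Collect_finite]) auto
  show "inj_on ?graph (carrier fin_sym)"
  proof (rule inj_onI, rule ext)
    fix f g x assume "?graph f = ?graph g"
    then have "(x, y) \<in> ?graph f \<longleftrightarrow> (x, y) \<in> ?graph g" for y by simp
    then show "f x = g x" by simp metis
  qed
qed

text \<open>Cayley's theorem: \<open>H\<close> acts on its finite carrier of naturals by left
  multiplication, and all other naturals are fixed.\<close>

lemma F_universal_fin_sym: "F_universal fin_sym"
  unfolding F_universal_def
proof (intro allI impI)
  fix H :: "nat monoid" assume H: "group H \<and> finite (carrier H)"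
  then interpret H: group H by simp
  define reg where "reg h x = (if x \<in> carrier H then h \<otimes>\<^bsub>H\<^esub> x else x)" for h x
  have comp: "reg (h \<otimes>\<^bsub>H\<^esub> h') = reg h \<circ> reg h'" if "h \<in> carrier H" "h' \<in> carrier H" for h h'
    using that by (auto simp: reg_def fun_eq_iff H.m_assoc)
  have one: "reg \<one>\<^bsub>H\<^esub> = id" by (auto simp: reg_def)
  have "permutation (reg h)" if h: "h \<in> carrier H" for h
    unfolding permutation
  proof
    have "reg h \<circ> reg (inv\<^bsub>H\<^esub> h) = id" "reg (inv\<^bsub>H\<^esub> h) \<circ> reg h = id"
      using comp[of h "inv\<^bsub>H\<^esub> h"] comp[of "inv\<^bsub>H\<^esub> h" h] h one by simp_all
    then show "bij (reg h)" using o_bij by blast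
    have "{x. reg h x \<noteq> x} \<subseteq> carrier H" by (auto simp: reg_def)
    then show "finite {x. reg h x \<noteq> x}" using H finite_subset by blast
  qed
  moreover have "inj_on reg (carrier H)"
  proof (rule inj_onI)
    fix h h' assume "h \<in> carrier H" "h' \<in> carrier H" "reg h = reg h'"
    then have "reg h \<one>\<^bsub>H\<^esub> = reg h' \<one>\<^bsub>H\<^esub>" "h \<in> carrier H" "h' \<in> carrier H" by simp_all
    then show "h = h'" by (simp add: reg_def)
  qed
  ultimately have "reg \<in> mon H fin_sym" using comp by (auto simp: mon_def hom_def)
  then show "embeds H fin_sym" unfolding embeds_def by blast
qed

section \<open>Composition of embeddings, and the orders of the groups\<close>

lemma embedsI: "f \<in> mon G H \<Longrightarrow> embeds G H"
  unfolding embeds_def by blast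

lemma embeds_trans:
  assumes "embeds G H" "embeds H L" shows "embeds G L"
proof -
  obtain f g where f: "f \<in> hom G H" "inj_on f (carrier G)" and g: "g \<in> hom H L" "inj_on g (carrier H)"
    using assms by (auto simp: embeds_def mon_def)
  have "inj_on (g \<circ> f) (carrier G)"
    using f g hom_carrier[OF f(1)] by (intro comp_inj_on) (auto intro: inj_on_subset)
  then have "g \<circ> f \<in> mon G L" using hom_compose[OF f(1) g(1)] by (simp add: mon_def)
  then show ?thesis by (rule embedsI)
qed

lemma F_universal_embeds:
  assumes "F_universal G" "embeds G H" shows "F_universal H"
  using assms embeds_trans[OF _ assms(2)] by (auto simp: F_universal_def)

text \<open>A function is coded by its graph over the support, a finite subset of an infinite set of
  size |V|.\<close>

lemma card_of_fin_supp:
  assumes "infinite V"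
  shows "|{f :: 'x \<Rightarrow> 'b::{zero,countable}. fin_supp V f}| \<le>o |V|"
proof -
  let ?graph = "\<lambda>f :: 'x \<Rightarrow> 'b. {(x, f x) | x. f x \<noteq> 0}"
  let ?F = "{f :: 'x \<Rightarrow> 'b. fin_supp V f}"
  have "inj_on ?graph ?F"
  proof (rule inj_onI, rule ext)
    fix f g x assume "?graph f = ?graph g"
    then have "(x, y) \<in> ?graph f \<longleftrightarrow> (x, y) \<in> ?graph g" for y by simp
    then show "f x = g x" by simp metis
  qed
  moreover have "?graph f \<in> Fpow (V \<times> UNIV)" if "fin_supp V f" for f
    using that by (auto simp: Fpow_def fin_supp_def intro: finite_surj[of "{x. f x \<noteq> 0}" _ "\<lambda>x. (x, f x)"])
  ultimately have "|?F| \<le>o |Fpow (V \<times> (UNIV :: 'b set))|"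
    unfolding card_of_ordLeq[symmetric] by (intro exI[of _ ?graph]) auto
  also have "|Fpow (V \<times> (UNIV :: 'b set))| =o |V \<times> (UNIV :: 'b set)|"
    using assms by (intro card_of_Fpow_infinite) (auto simp: finite_cartesian_product_iff)
  also have "|V \<times> (UNIV :: 'b set)| \<le>o |V|"
  proof -
    have "|UNIV :: 'b set| \<le>o natLeq" by (simp flip: countable_card_le_natLeq)
    then have "|UNIV :: 'b set| \<le>o |V|"
      by (rule ordLeq_transitive) (use assms infinite_iff_natLeq_ordLeq in blast)
    then show ?thesis using assms
      by (intro card_of_Sigma_ordLeq_infinite) auto
  qed
  finally show ?thesis .
qed

lemma card_of_heis_fin_sym:
  assumes "infinite V"
  shows "|carrier (heis V c \<times>\<times> fin_sym)| =o |V|"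
proof -
  let ?F = "{f :: 'a \<Rightarrow> rat. fin_supp V f}" and ?F2 = "{f :: 'a \<times> 'a \<Rightarrow> rat. fin_supp (V \<times> V) f}"
  have F: "|?F| \<le>o |V|" by (rule card_of_fin_supp[OF assms])
  have "|?F2| \<le>o |V \<times> V|" using assms by (intro card_of_fin_supp) (auto simp: finite_cartesian_product_iff)
  also have "|V \<times> V| =o |V|" by (rule card_of_Times_same_infinite[OF assms])
  finally have F2: "|?F2| \<le>o |V|" .
  have S: "|carrier fin_sym| \<le>o |V|"
    using countable_fin_sym[unfolded countable_card_le_natLeq]
    by (rule ordLeq_transitive) (use assms infinite_iff_natLeq_ordLeq in blast)
  have "|(?F \<times> ?F \<times> ?F2) \<times> carrier fin_sym| \<le>o |V|"
    using assms F F2 S by (intro card_of_Sigma_ordLeq_infinite ballI) auto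
  moreover have "carrier (heis V c \<times>\<times> fin_sym) \<subseteq> (?F \<times> ?F \<times> ?F2) \<times> carrier fin_sym"
    by (auto simp: heis_carrier)
  ultimately have le: "|carrier (heis V c \<times>\<times> fin_sym)| \<le>o |V|"
    using ordLeq_transitive[OF card_of_mono1] by blast
  let ?e = "\<lambda>v. ((unit_fun v, \<lambda>_. 0, \<lambda>_. 0) :: 'a heis, id :: nat \<Rightarrow> nat)"
  have "inj_on ?e V" by (auto simp: inj_on_def unit_fun_def fun_eq_iff of_bool_def split: if_splits)
  moreover have "?e ` V \<subseteq> carrier (heis V c \<times>\<times> fin_sym)"
    using divisible_elt_carrier[OF group_heis heis_divisible_gens(1)] permutation_id by auto
  ultimately have "|V| \<le>o |carrier (heis V c \<times>\<times> fin_sym)|"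
    unfolding card_of_ordLeq[symmetric] by blast
  with le show ?thesis by (simp add: ordIso_iff_ordLeq)
qed

text \<open>Projecting to the first factor cannot kill a commutator: its image would be a finitary
  permutation, hence of finite order, whereas the commutator has infinite order and the embedding is
  injective. So \<open>heis_hom_labels\<close> applies to the projection.\<close>

lemma heis_fin_sym_embeds_labels:
  assumes emb: "embeds (heis V c \<times>\<times> fin_sym) (heis V' c' \<times>\<times> fin_sym)"
    and primes: "\<And>w v p. w \<in> V \<Longrightarrow> v \<in> V \<Longrightarrow> p \<in> c w v \<Longrightarrow> Factorial_Ring.prime p \<and> p \<notin> {2, 3}"
  obtains g h where "g \<in> V \<rightarrow> V'" "h \<in> V \<rightarrow> V'" "\<And>w v. w \<in> V \<Longrightarrow> v \<in> V \<Longrightarrow> c w v \<subseteq> c' (h w) (g v)"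
proof -
  let ?G = "heis V c" and ?H = "heis V' c'"
  obtain f where "f \<in> mon (?G \<times>\<times> fin_sym) (?H \<times>\<times> fin_sym)" using emb unfolding embeds_def by blast
  then have hom: "f \<in> hom (?G \<times>\<times> fin_sym) (?H \<times>\<times> fin_sym)" and inj: "inj_on f (carrier (?G \<times>\<times> fin_sym))"
    by (auto simp: mon_def)
  let ?i = "\<lambda>x. (x, \<one>\<^bsub>fin_sym\<^esub>)"
  interpret S: group fin_sym by (rule group_fin_sym)
  interpret G: group ?G by (rule group_heis)
  interpret H: group ?H by (rule group_heis)
  have i: "?i \<in> hom ?G (?G \<times>\<times> fin_sym)" by (auto simp: hom_def permutation_id simp del: fin_sym_simps(3)) (auto simp: permutation_id)
  have fi: "f \<circ> ?i \<in> hom ?G (?H \<times>\<times> fin_sym)" by (rule hom_compose[OF i hom])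
  have \<phi>: "fst \<circ> (f \<circ> ?i) \<in> hom ?G ?H" using fi by (auto simp: hom_def Pi_iff mult_DirProd')
  have \<psi>: "snd \<circ> (f \<circ> ?i) \<in> hom ?G fin_sym" using fi by (auto simp: hom_def Pi_iff mult_DirProd' simp del: fin_sym_simps)
  have nontriv: "(fst \<circ> (f \<circ> ?i)) (heis_comm w v) \<noteq> \<one>\<^bsub>?H\<^esub>" if "w \<in> V" "v \<in> V" for w v
  proof
    let ?z = "heis_comm w v"
    assume 1: "(fst \<circ> (f \<circ> ?i)) ?z = \<one>\<^bsub>?H\<^esub>"
    have z: "?z \<in> carrier ?G" by (rule heis_comm_carrier[OF that])
    interpret \<phi>: group_hom ?G ?H "fst \<circ> (f \<circ> ?i)" using \<phi> by unfold_locales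
    interpret \<psi>: group_hom ?G fin_sym "snd \<circ> (f \<circ> ?i)" using \<psi> by unfold_locales
    obtain n :: nat where n: "n > 0" "(snd \<circ> (f \<circ> ?i)) ?z [^]\<^bsub>fin_sym\<^esub> n = \<one>\<^bsub>fin_sym\<^esub>"
      using fin_sym_torsion \<psi>.hom_closed[OF z] by blast
    have "(f \<circ> ?i) (?z [^]\<^bsub>?G\<^esub> n) = (f \<circ> ?i) \<one>\<^bsub>?G\<^esub>"
    proof (rule prod_eqI)
      show "fst ((f \<circ> ?i) (?z [^]\<^bsub>?G\<^esub> n)) = fst ((f \<circ> ?i) \<one>\<^bsub>?G\<^esub>)"
        using \<phi>.hom_nat_pow[OF z, of n] \<phi>.hom_one 1 H.nat_pow_one[of n] by simp
      show "snd ((f \<circ> ?i) (?z [^]\<^bsub>?G\<^esub> n)) = snd ((f \<circ> ?i) \<one>\<^bsub>?G\<^esub>)"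
        using \<psi>.hom_nat_pow[OF z, of n] \<psi>.hom_one n(2) by simp
    qed
    moreover have "?i (?z [^]\<^bsub>?G\<^esub> n) \<in> carrier (?G \<times>\<times> fin_sym)" "?i \<one>\<^bsub>?G\<^esub> \<in> carrier (?G \<times>\<times> fin_sym)"
      using z G.nat_pow_closed G.one_closed S.one_closed by auto
    ultimately have "?z [^]\<^bsub>?G\<^esub> n = \<one>\<^bsub>?G\<^esub>" using inj by (auto dest: inj_onD)
    then have "(\<lambda>q. of_nat n * unit_fun (w, v) q) = (\<lambda>_. 0)"
      by (simp add: heis_comm_def heis_nat_pow_centre)
    from fun_cong[OF this, of "(w, v)"] have "of_nat n * unit_fun (w, v) (w, v) = 0" .
    with n(1) show False by (simp add: unit_fun_def)
  qed
  show thesis by (rule heis_hom_labels[OF \<phi>]) (erule (1) nontriv, erule (2) primes, rule that)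
qed


section \<open>Marked rigid groups\<close>

text \<open>One labelling is fixed per set, so that two groups built on the same set carry the same
  labelling and rigidity applies to maps between them.\<close>

definition rigid_labelling :: "'x set \<Rightarrow> 'x \<Rightarrow> 'x \<Rightarrow> nat set" where
  "rigid_labelling V = (SOME s. rigid V s)"

lemma rigid_labelling:
  assumes "g \<in> V \<rightarrow> V" "\<And>x y. \<lbrakk>x \<in> V; y \<in> V; x \<noteq> y\<rbrakk> \<Longrightarrow> rigid_labelling V x y \<subseteq> rigid_labelling V (g x) (g y)" "x \<in> V"
  shows "g x = x"
proof -
  have "rigid V (rigid_labelling V)" unfolding rigid_labelling_def by (rule someI_ex[OF exists_rigid])
  with assms show ?thesis unfolding rigid_def by blast
qed

text \<open>Codes labels by primes while reserving 2 and 3 for the generators.\<close>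

definition label_prime :: "'l::countable \<Rightarrow> nat" where
  "label_prime = (SOME e. inj e \<and> range e \<subseteq> {p. Factorial_Ring.prime p} - {2, 3})"

lemma label_prime: "inj (label_prime :: 'l::countable \<Rightarrow> nat)"
  "Factorial_Ring.prime (label_prime (l :: 'l))" "label_prime l \<notin> {2, 3}"
proof -
  have "infinite ({p :: nat. Factorial_Ring.prime p} - {2, 3})"
    using primes_infinite by simp
  then obtain f :: "nat \<Rightarrow> nat" where "inj f" "range f \<subseteq> {p. Factorial_Ring.prime p} - {2, 3}"
    using infinite_countable_subset by blast
  then have "\<exists>e :: 'l \<Rightarrow> nat. inj e \<and> range e \<subseteq> {p. Factorial_Ring.prime p} - {2, 3}"
    by (intro exI[of _ "f \<circ> to_nat"]) (auto intro: inj_compose)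
  from someI_ex[OF this]
  have "inj (label_prime :: 'l \<Rightarrow> nat) \<and> range (label_prime :: 'l \<Rightarrow> nat) \<subseteq> {p. Factorial_Ring.prime p} - {2, 3}"
    unfolding label_prime_def .
  then show "inj (label_prime :: 'l \<Rightarrow> nat)" "Factorial_Ring.prime (label_prime l)" "label_prime l \<notin> {2, 3}"
    by auto
qed

text \<open>The diagonal labels list bits together with their positions: the part (0), membership in the marked
  set (1), membership of \<open>n\<close> in the level (\<open>n + 2\<close>). Thus inclusion of label sets forces equal bits.\<close>
fun marked_labels :: "'b set \<Rightarrow> nat set \<Rightarrow> 'b set \<Rightarrow> 'a set \<Rightarrow> 'a set \<Rightarrow> 'b + 'a \<Rightarrow> 'b + 'a \<Rightarrow> (nat + nat \<times> bool) set" where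
  "marked_labels B i Q A P (Inl x) (Inl y) =
    (if x = y then Inr ` ({(0, True), (1, x \<in> Q)} \<union> range (\<lambda>n. (n + 2, n \<in> i))) else Inl ` rigid_labelling B x y)"
| "marked_labels B i Q A P (Inr x) (Inr y) =
    (if x = y then Inr ` {(0, False), (1, x \<in> P)} else Inl ` rigid_labelling A x y)"
| "marked_labels B i Q A P _ _ = {}"

text \<open>In the application \<open>A\<close> is the field of \<kappa> with its varying subset
  \<open>P\<close>, while \<open>B\<close>, \<open>i\<close> and \<open>Q\<close> are the set of the
  level, the code of the level and the subset that identifies \<kappa> within the level.\<close>

definition marked_group where
  "marked_group B i Q A P = heis (B <+> A) (\<lambda>u v. label_prime ` marked_labels B i Q A P u v) \<times>\<times> fin_sym"

lemma group_marked_group: "group (marked_group B i Q A P)"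
  unfolding marked_group_def by (intro DirProd_group group_heis group_fin_sym)

lemma F_universal_marked_group: "F_universal (marked_group B i Q A P)"
proof (rule F_universal_embeds[OF F_universal_fin_sym embedsI])
  let ?H = "heis (B <+> A) (\<lambda>u v. label_prime ` marked_labels B i Q A P u v)"
  interpret group ?H by (rule group_heis)
  show "(\<lambda>f. (\<one>\<^bsub>?H\<^esub>, f)) \<in> mon fin_sym (marked_group B i Q A P)"
    using one_closed l_one[OF one_closed] unfolding marked_group_def
    by (simp add: mon_def hom_def inj_on_def del: heis_one_simp)
qed

text \<open>The maps obtained from the embedding agree and respect the two parts, so they transfer
  the bits. Once the level codes agree, the sets \<open>B\<close> agree too; rigidity turns the map
  on each common part into the identity, and the marked subsets coincide.\<close>

lemma marked_group_embeds:
  assumes emb: "embeds (marked_group B i Q A P) (marked_group B' i' Q' A' P')"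
    and ne: "B \<noteq> {}" "A \<noteq> {}" and BB: "i = i' \<Longrightarrow> B = B'"
  shows "i = i'" "Q \<inter> B = Q' \<inter> B" "A = A' \<Longrightarrow> P \<inter> A = P' \<inter> A"
proof -
  let ?c = "marked_labels B i Q A P" and ?c' = "marked_labels B' i' Q' A' P'"
  obtain g h where g: "g \<in> B <+> A \<rightarrow> B' <+> A'" "h \<in> B <+> A \<rightarrow> B' <+> A'"
    and "\<And>u v. u \<in> B <+> A \<Longrightarrow> v \<in> B <+> A \<Longrightarrow> label_prime ` ?c u v \<subseteq> label_prime ` ?c' (h u) (g v)"
    by (rule heis_fin_sym_embeds_labels[OF emb[unfolded marked_group_def]]) (auto simp: label_prime(2) label_prime(3)[simplified])
  then have lab: "?c u v \<subseteq> ?c' (h u) (g v)" if "u \<in> B <+> A" "v \<in> B <+> A" for u v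
    using that label_prime(1) by (metis inj_image_subset_iff)
  have diag: "h u = g u \<and> isl (g u) = isl u" if "u \<in> B <+> A" for u
    using lab[OF that that] by (cases u; cases "h u"; cases "g u") (auto split: if_splits)
  have lab': "?c u v \<subseteq> ?c' (g u) (g v)" if "u \<in> B <+> A" "v \<in> B <+> A" for u v
    using lab[OF that] diag that by simp
  define gl where "gl x = projl (g (Inl x))" for x
  have gl: "g (Inl x) = Inl (gl x)" "gl x \<in> B'" if "x \<in> B" for x
    using diag[OF InlI[OF that]] funcset_mem[OF g(1) InlI[OF that]] by (auto simp: gl_def isl_def)
  define gr where "gr x = projr (g (Inr x))" for x
  have gr: "g (Inr x) = Inr (gr x)" "gr x \<in> A'" if "x \<in> A" for x
    using diag[OF InrI[OF that]] funcset_mem[OF g(1) InrI[OF that]] by (auto simp: gr_def elim: PlusE)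
  have bits: "(\<forall>n. n \<in> i \<longleftrightarrow> n \<in> i') \<and> (x \<in> Q \<longleftrightarrow> gl x \<in> Q')" if "x \<in> B" for x
  proof -
    have "Inr ` ({(0, True), (1, x \<in> Q)} \<union> range (\<lambda>n. (n + 2, n \<in> i))) \<subseteq>
       (Inr ` ({(0, True), (1, gl x \<in> Q')} \<union> range (\<lambda>n. (n + 2, n \<in> i'))) :: (nat + nat \<times> bool) set)"
      using lab'[OF InlI[OF that] InlI[OF that]] gl that by (simp del: image_insert image_Un)
    then have s: "{(0, True), (1, x \<in> Q)} \<union> range (\<lambda>n. (n + 2, n \<in> i)) \<subseteq>
       ({(0, True), (1, gl x \<in> Q')} \<union> range (\<lambda>n. (n + 2, n \<in> i')) :: (nat \<times> bool) set)"
      by (simp only: inj_image_subset_iff inj_Inr)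
    have "(n + 2, n \<in> i) \<in> {(0, True), (1, x \<in> Q)} \<union> range (\<lambda>n. (n + 2, n \<in> i))" for n by blast
    with s have "(n + 2, n \<in> i) \<in> {(0, True), (1, gl x \<in> Q')} \<union> range (\<lambda>n. (n + 2, n \<in> i'))" for n by blast
    then have "\<forall>n. n \<in> i \<longleftrightarrow> n \<in> i'" by auto
    moreover have "x \<in> Q \<longleftrightarrow> gl x \<in> Q'" using s by auto
    ultimately show ?thesis by blast
  qed
  show "i = i'" using ne(1) bits by blast
  then have "B = B'" by (rule BB)
  have "gl x = x" if "x \<in> B" for x
  proof (rule rigid_labelling[OF _ _ that])
    show "gl \<in> B \<rightarrow> B" using gl \<open>B = B'\<close> by auto
    fix x y assume xy: "x \<in> B" "y \<in> B" "x \<noteq> y"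
    show "rigid_labelling B x y \<subseteq> rigid_labelling B (gl x) (gl y)"
      using lab'[OF InlI[OF xy(1)] InlI[OF xy(2)]] xy gl \<open>B = B'\<close> by (auto split: if_splits)
  qed
  with bits show "Q \<inter> B = Q' \<inter> B" by auto
  assume "A = A'"
  have "gr x = x" if "x \<in> A" for x
  proof (rule rigid_labelling[OF _ _ that])
    show "gr \<in> A \<rightarrow> A" using gr \<open>A = A'\<close> by auto
    fix x y assume xy: "x \<in> A" "y \<in> A" "x \<noteq> y"
    show "rigid_labelling A x y \<subseteq> rigid_labelling A (gr x) (gr y)"
      using lab'[OF InrI[OF xy(1)] InrI[OF xy(2)]] xy gr \<open>A = A'\<close> by (auto split: if_splits)
  qed
  moreover have "x \<in> P \<longleftrightarrow> gr x \<in> P'" if "x \<in> A" for x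
    using lab'[OF InrI[OF that] InrI[OF that]] gr that by auto
  ultimately show "P \<inter> A = P' \<inter> A" by auto
qed

lemma card_of_marked_group:
  assumes "infinite A" "|B| \<le>o |A|"
  shows "|carrier (marked_group B i Q A P)| =o |A|"
proof -
  have "infinite (B <+> A)" using assms(1) by (simp add: finite_Plus_iff)
  then have "|carrier (marked_group B i Q A P)| =o |B <+> A|"
    unfolding marked_group_def by (rule card_of_heis_fin_sym)
  also have "|B <+> A| =o |A|" using card_of_Plus_infinite2[OF assms] .
  finally show ?thesis .
qed

text \<open>Moves a group along an injection, so that all members of the family can live on the one
  type \<open>'a\<close>.\<close>

definition transport :: "('g \<Rightarrow> 'a) \<Rightarrow> ('g, 'm) monoid_scheme \<Rightarrow> 'a monoid" where
  "transport e G = \<lparr>carrier = e ` carrier G,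
     monoid.mult = (\<lambda>x y. e (inv_into (carrier G) e x \<otimes>\<^bsub>G\<^esub> inv_into (carrier G) e y)),
     one = e \<one>\<^bsub>G\<^esub>\<rparr>"

lemma transport:
  assumes "group G" "inj_on e (carrier G)"
  shows "group (transport e G)" "embeds G (transport e G)" "embeds (transport e G) G" "carrier (transport e G) = e ` carrier G"
proof -
  interpret group G by fact
  show car: "carrier (transport e G) = e ` carrier G" by (simp add: transport_def)
  have "e \<in> iso G (transport e G)"
    using assms(2) by (auto simp: iso_def hom_def bij_betw_def transport_def)
  then have "group ((transport e G)\<lparr>one := e \<one>\<^bsub>G\<^esub>\<rparr>)" by (rule iso_imp_img_group)
  then show "group (transport e G)" by (simp add: transport_def)
  show "embeds G (transport e G)"
    using assms(2) by (intro embedsI[of e]) (auto simp: mon_def hom_def transport_def)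
  show "embeds (transport e G) G"
    using assms(2) by (intro embedsI[of "inv_into (carrier G) e"])
      (auto simp: mon_def hom_def transport_def inj_on_inv_into)
qed


section \<open>Beth numbers\<close>

lemma Field_Restr_underS:
  assumes "Well_order W" shows "Field (Restr W (underS W i)) = underS W i"
proof -
  interpret wo: wo_rel W by standard (rule assms)
  show ?thesis by (rule Field_Restr_ofilter[OF assms wo.underS_ofilter])
qed

lemma Restr_Restr_underS:
  assumes "Well_order W" "j \<in> underS W i"
  shows "Restr (Restr W (underS W i)) (underS (Restr W (underS W i)) j) = Restr W (underS W j)"
proof -
  interpret wo: wo_rel W by standard (rule assms)
  have "underS W j \<subseteq> underS W i"
    using assms(2) underS_incr[OF wo.TRANS wo.ANTISYM, of j i] by (auto simp: underS_def)
  moreover from this have "underS (Restr W (underS W i)) j = underS W j"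
    using assms(2) by (auto simp: underS_def)
  ultimately show ?thesis by auto
qed

text \<open>Of the initial segments of two different elements, one is a proper initial segment of
  the other and therefore strictly shorter.\<close>

lemma underS_inj:
  assumes "Well_order r" "a \<in> Field r" "b \<in> Field r" "Restr r (underS r a) =o Restr r (underS r b)"
  shows "a = b"
proof (rule ccontr)
  interpret wo: wo_rel r by standard (rule assms)
  have less: "\<not> Restr r (underS r a) =o Restr r (underS r b)" if "(a, b) \<in> r" "a \<noteq> b" for a b
  proof -
    have "underS r a \<subset> underS r b"
    proof
      show "underS r a \<subseteq> underS r b" by (rule underS_incr[OF wo.TRANS wo.ANTISYM that(1)])
      have "a \<in> underS r b" "a \<notin> underS r a" using that by (auto simp: underS_def)
      then show "underS r a \<noteq> underS r b" by blast
    qed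
    then have "Restr r (underS r a) <o Restr r (underS r b)"
      using ofilter_subset_ordLess[OF assms(1) wo.underS_ofilter wo.underS_ofilter] by blast
    then show ?thesis by (rule not_ordLess_ordIso)
  qed
  assume "a \<noteq> b"
  moreover have "(a, b) \<in> r \<or> (b, a) \<in> r" using wo.TOTALS assms(2,3) by blast
  ultimately show False using less[of a b] less[of b a] assms(4) ordIso_symmetric[OF assms(4)] by blast
qed

text \<open>Each \<open>ord x\<close> is isomorphic to the initial segment below some element of
  \<open>Field l\<close>, and different \<open>x\<close> give different elements.\<close>

lemma card_of_small_ordinals:
  assumes l: "Card_order l" and small: "\<And>x. x \<in> S \<Longrightarrow> ord x <o l"
    and inj: "\<And>x y. \<lbrakk>x \<in> S; y \<in> S; ord x =o ord y\<rbrakk> \<Longrightarrow> x = y"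
  shows "|S| \<le>o l"
proof -
  have wl: "Well_order l" by (rule card_order_on_well_order_on[OF l])
  have "\<forall>x\<in>S. \<exists>a. a \<in> Field l \<and> ord x =o Restr l (underS l a)"
  proof
    fix x assume x: "x \<in> S"
    have "Well_order (ord x)" using small[OF x] unfolding ordLess_def by blast
    from iffD1[OF ordLess_iff_ordIso_Restr[OF wl this] small[OF x]]
    show "\<exists>a. a \<in> Field l \<and> ord x =o Restr l (underS l a)" unfolding Bex_def .
  qed
  from bchoice[OF this] obtain a
    where a: "\<And>x. x \<in> S \<Longrightarrow> a x \<in> Field l \<and> ord x =o Restr l (underS l (a x))" by blast
  have "inj_on a S"
  proof (rule inj_onI)
    fix x y assume xy: "x \<in> S" "y \<in> S" "a x = a y"
    have "ord x =o Restr l (underS l (a y))" using a[OF xy(1)] xy(3) by simp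
    moreover have "Restr l (underS l (a y)) =o ord y" using a[OF xy(2)] by (rule ordIso_symmetric[OF conjunct2])
    ultimately have "ord x =o ord y" by (rule ordIso_transitive)
    then show "x = y" by (rule inj[OF xy(1,2)])
  qed
  then have "|S| \<le>o |Field l|" by (rule card_of_ordLeqI) (use a in blast)
  also have "|Field l| =o l" by (rule card_of_Field_ordIso[OF l])
  finally show ?thesis .
qed

section \<open>Suprema of cardinals and the beth recursion\<close>

lemma is_card_sup_upper: "is_card_sup S c \<Longrightarrow> s \<in> S \<Longrightarrow> s \<le>o c"
  by (simp add: is_card_sup_def)

lemma is_card_sup_least:
  fixes c d :: "'a rel"
  shows "is_card_sup S c \<Longrightarrow> Card_order d \<Longrightarrow> (\<And>s. s \<in> S \<Longrightarrow> s \<le>o d) \<Longrightarrow> c \<le>o d"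
  by (simp add: is_card_sup_def)

lemma is_beth_nonemptyE:
  fixes W :: "'i rel" and c :: "'a rel"
  assumes "is_beth W c" "Field W \<noteq> {}"
  obtains b :: "'i \<Rightarrow> 'a rel" where "Well_order W" "\<And>i. i \<in> Field W \<Longrightarrow> is_beth (Restr W (underS W i)) (b i)"
    "is_card_sup ((\<lambda>i. ctwo ^c b i) ` Field W) c"
  using assms(1)
proof cases
  case zero
  with assms(2) show ?thesis by blast
next
  case (sup b)
  then show ?thesis by (intro that[of b]) auto
qed

lemma Card_order_is_beth:
  assumes "is_beth W c" shows "Card_order c"
  using assms
proof cases
  case (sup b)
  then show ?thesis unfolding is_card_sup_def by blast
qed

lemma natLeq_ordLeq_is_beth: "is_beth W c \<Longrightarrow> natLeq \<le>o c"
proof (induction rule: is_beth.induct)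
  case (zero W c)
  then show ?case by (simp add: ordIso_iff_ordLeq)
next
  case (sup W b c)
  then obtain i where i: "i \<in> Field W" by blast
  then have b: "is_beth (Restr W (underS W i)) (b i)" "natLeq \<le>o b i" using bspec[OF sup.IH i] by blast+
  note b(2)
  also have "b i <o ctwo ^c b i" by (rule ordLess_ctwo_cexp[OF Card_order_is_beth[OF b(1)]])
  also have "ctwo ^c b i \<le>o c" by (rule is_card_sup_upper[OF sup.hyps(3) imageI[OF i]])
  finally show ?case by (rule ordLess_imp_ordLeq)
qed

lemma cexp_ctwo_cong:
  assumes "c =o d" "Card_order c" shows "ctwo ^c c =o ctwo ^c d"
  by (rule cexp_cong2[OF assms(1) Card_order_ctwo assms(2)])

text \<open>The earlier beth numbers enter \<open>is_beth\<close> as existential witnesses. By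
  induction any two choices agree up to \<open>=o\<close>, so each supremum bounds the family of the
  other.\<close>

lemma is_beth_unique:
  fixes W :: "'i rel" and c c' :: "'a rel"
  shows "is_beth W c \<Longrightarrow> is_beth W c' \<Longrightarrow> c =o c'"
proof (induction arbitrary: c' rule: is_beth.induct)
  case (zero W c)
  from zero.prems have "c' =o natLeq" using zero.hyps by cases auto
  then show ?case using zero.hyps by (metis ordIso_symmetric ordIso_transitive)
next
  case (sup W b c)
  obtain b' :: "'i \<Rightarrow> 'a rel" where b': "Well_order W" "\<And>i. i \<in> Field W \<Longrightarrow> is_beth (Restr W (underS W i)) (b' i)"
    "is_card_sup ((\<lambda>i. ctwo ^c b' i) ` Field W) c'"
    by (rule is_beth_nonemptyE[OF sup.prems sup.hyps(2)]) (rule that)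
  have eq: "ctwo ^c b i =o ctwo ^c b' i" if i: "i \<in> Field W" for i
  proof (rule cexp_ctwo_cong)
    have IH: "is_beth (Restr W (underS W i)) (b i)"
      "\<And>d :: 'a rel. is_beth (Restr W (underS W i)) d \<Longrightarrow> b i =o d"
      using bspec[OF sup.IH i] by blast+
    show "b i =o b' i" by (rule IH(2)[OF b'(2)[OF i]])
    show "Card_order (b i)" by (rule Card_order_is_beth[OF IH(1)])
  qed
  have "c \<le>o c'"
  proof (rule is_card_sup_least[OF sup.hyps(3)])
    fix s assume "s \<in> (\<lambda>i. ctwo ^c b i) ` Field W"
    then obtain i where i: "i \<in> Field W" "s = ctwo ^c b i" by (rule imageE)
    show "s \<le>o c'"
      unfolding i(2) by (rule ordIso_ordLeq_trans[OF eq[OF i(1)] is_card_sup_upper[OF b'(3) imageI[OF i(1)]]])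
  qed (rule Card_order_is_beth[OF sup.prems])
  moreover have "c' \<le>o c"
  proof (rule is_card_sup_least[OF b'(3)])
    fix s assume "s \<in> (\<lambda>i. ctwo ^c b' i) ` Field W"
    then obtain i where i: "i \<in> Field W" "s = ctwo ^c b' i" by (rule imageE)
    show "s \<le>o c"
      unfolding i(2)
      by (rule ordIso_ordLeq_trans[OF ordIso_symmetric[OF eq[OF i(1)]] is_card_sup_upper[OF sup.hyps(3) imageI[OF i(1)]]])
  next
    show "Card_order c" using sup.hyps(3) by (simp add: is_card_sup_def)
  qed
  ultimately show ?case by (simp add: ordIso_iff_ordLeq)
qed

text \<open>Serves to place \<kappa> at the least level whose power exceeds it: minimality bounds
  the earlier powers by \<kappa>, and \<open>b i\<close> is aleph_0 or their supremum.\<close>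

lemma is_beth_ordLeq:
  fixes b :: "'i \<Rightarrow> 'b rel" and \<kappa> :: "'a rel"
  assumes W: "Well_order W" "i \<in> Field W"
    and b: "\<And>j. j \<in> Field W \<Longrightarrow> is_beth (Restr W (underS W j)) (b j)"
    and \<kappa>: "Cinfinite \<kappa>" and below: "\<And>j. j \<in> underS W i \<Longrightarrow> ctwo ^c b j \<le>o \<kappa>"
  shows "b i \<le>o \<kappa>"
proof (rule ccontr)
  note bi = b[OF W(2)]
  assume "\<not> b i \<le>o \<kappa>"
  then have less: "\<kappa> <o b i"
    using not_ordLeq_iff_ordLess[OF card_order_on_well_order_on[OF conjunct2[OF \<kappa>]]
        card_order_on_well_order_on[OF Card_order_is_beth[OF bi]]] by blast
  from bi show False
  proof cases
    case zero
    from zero(3) have "b i \<le>o \<kappa>" by (rule ordIso_ordLeq_trans[OF _ natLeq_ordLeq_cinfinite[OF \<kappa>]])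
    with \<open>\<not> b i \<le>o \<kappa>\<close> show False by contradiction
  next
    case (sup b')
    \<comment> \<open>Leastness in \<open>is_card_sup\<close> speaks of cardinals on the type of
      \<open>b i\<close> only. Being smaller than \<open>b i\<close>, \<kappa> has a copy
      there.\<close>
    obtain p :: "'b rel" where p: "\<kappa> =o p" "p <o b i" using iffD1[OF internalize_ordLess less] by blast
    have "Card_order p" by (rule Card_order_ordIso2[OF _ p(1)]) (use \<kappa> in blast)
    moreover have "ctwo ^c b' j \<le>o p" if "j \<in> Field (Restr W (underS W i))" for j
    proof -
      have j: "j \<in> underS W i" using that Field_Restr_underS[OF W(1)] by simp
      then have jW: "j \<in> Field W" by (rule underS_Field)
      have b'j: "is_beth (Restr W (underS W j)) (b' j)"
        using bspec[OF sup(3) that] unfolding Restr_Restr_underS[OF W(1) j] .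
      have "ctwo ^c b' j =o ctwo ^c b j"
        by (rule cexp_ctwo_cong[OF is_beth_unique[OF b'j b[OF jW]] Card_order_is_beth[OF b'j]])
      from ordIso_ordLeq_trans[OF this below[OF j]] show ?thesis using p(1) by (rule ordLeq_ordIso_trans)
    qed
    ultimately have "b i \<le>o p" using sup(4) by (simp add: is_card_sup_def)
    with not_ordLess_ordLeq[OF p(2)] show False by contradiction
  qed
qed

text \<open>A well-order at least as long as the cardinal \<open>l\<close> has a field of at least
  that size.\<close>

lemma ordLess_card_of_imp_Restr_underS_ordLess:
  assumes "Card_order l" "Well_order r" "|underS r x| <o l"
  shows "Restr r (underS r x) <o l"
proof (rule ccontr)
  have w: "Well_order l" "Well_order (Restr r (underS r x))"
    using card_order_on_well_order_on[OF assms(1)] Well_order_Restr[OF assms(2)] by auto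
  assume "\<not> ?thesis"
  then have "l \<le>o Restr r (underS r x)" using not_ordLess_iff_ordLeq[OF w] by blast
  then have "|Field l| \<le>o |Field (Restr r (underS r x))|" by (rule card_of_mono2)
  then have "l \<le>o |underS r x|"
    using ordIso_ordLeq_trans[OF ordIso_symmetric[OF card_of_Field_ordIso[OF assms(1)]]]
    by (simp add: Field_Restr_underS[OF assms(2)])
  with not_ordLess_ordLeq[OF assms(3)] show False by contradiction
qed

text \<open>The level of \<open>\<kappa>\<close> is the least \<open>i\<close> with \<open>\<kappa> < 2^b i\<close>; there are at most \<open>2^b i\<close> cardinals below
  \<open>2^b i\<close>. If there is no such \<open>i\<close>, then \<open>\<kappa>\<close> is large enough for every level, and its position in a
  well-order of \<open>K\<close> of type \<open>|K| = sup 2^b i\<close> is used in place of \<open>\<kappa>\<close>.\<close>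
lemma beth_levels:
  fixes K :: "'a rel set" and W :: "'i rel"
  assumes inf: "\<forall>\<kappa>\<in>K. Cinfinite \<kappa>"
    and distinct: "pairwise (\<lambda>\<kappa> \<mu>. \<not> \<kappa> =o \<mu>) K"
    and beth: "is_beth W |K|" and W: "Field W \<noteq> {}"
  obtains lev :: "'a rel \<Rightarrow> 'i" and B :: "'i \<Rightarrow> 'a rel set" and Q :: "'a rel \<Rightarrow> 'a rel set"
  where "\<And>\<kappa>. \<kappa> \<in> K \<Longrightarrow> B (lev \<kappa>) \<noteq> {}"
    "\<And>\<kappa>. \<kappa> \<in> K \<Longrightarrow> |B (lev \<kappa>)| \<le>o \<kappa>" "\<And>\<kappa>. \<kappa> \<in> K \<Longrightarrow> Q \<kappa> \<subseteq> B (lev \<kappa>)"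
    "inj_on (\<lambda>\<kappa>. (lev \<kappa>, Q \<kappa>)) K"
proof -
  obtain b :: "'i \<Rightarrow> 'a rel rel" where WO: "Well_order W"
    and b: "\<And>i. i \<in> Field W \<Longrightarrow> is_beth (Restr W (underS W i)) (b i)"
    and sup: "is_card_sup ((\<lambda>i. ctwo ^c b i) ` Field W) |K|"
    by (rule is_beth_nonemptyE[OF beth W]) (rule that)
  interpret W: wo_rel W by standard (rule WO)
  have cb: "Card_order (b i)" if "i \<in> Field W" for i using Card_order_is_beth[OF b[OF that]] .
  have two: "Cinfinite (ctwo ^c b i)" if "i \<in> Field W" for i
  proof -
    have "natLeq \<le>o ctwo ^c b i"
      using ordLeq_transitive[OF natLeq_ordLeq_is_beth[OF b[OF that]] ordLess_imp_ordLeq[OF ordLess_ctwo_cexp[OF cb[OF that]]]] .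
    from cinfinite_mono[OF this natLeq_cinfinite] show ?thesis by (simp add: Card_order_cexp)
  qed
  define K1 where "K1 = {\<kappa> \<in> K. \<exists>i\<in>Field W. \<kappa> <o ctwo ^c b i}"
  have wo\<kappa>: "Well_order \<kappa>" if "\<kappa> \<in> K" for \<kappa> by (rule card_order_on_well_order_on) (use inf that in blast)
  have wo2: "Well_order (ctwo ^c b i)" for i by (rule card_order_on_well_order_on[OF Card_order_cexp])
  have "\<exists>i\<in>Field W. \<kappa> <o ctwo ^c b i \<and> b i \<le>o \<kappa>" if K1: "\<kappa> \<in> K1" for \<kappa>
  proof -
    have \<kappa>: "\<kappa> \<in> K" using K1 by (simp add: K1_def)
    obtain i0 where "i0 \<in> {i \<in> Field W. \<kappa> <o ctwo ^c b i}" using K1 unfolding K1_def by blast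
    then obtain i where i: "i \<in> {i \<in> Field W. \<kappa> <o ctwo ^c b i}"
      and min: "\<And>j. (j, i) \<in> W - Id \<Longrightarrow> j \<notin> {i \<in> Field W. \<kappa> <o ctwo ^c b i}"
      by (rule wfE_min[OF W.WF]) (rule that)
    have "ctwo ^c b j \<le>o \<kappa>" if "j \<in> underS W i" for j
    proof -
      have "(j, i) \<in> W - Id" "j \<in> Field W" using that by (auto simp: underS_def Field_def)
      then have "\<not> \<kappa> <o ctwo ^c b j" using min by blast
      then show ?thesis using not_ordLess_iff_ordLeq[OF wo2 wo\<kappa>[OF \<kappa>]] by blast
    qed
    moreover have "i \<in> Field W" "Cinfinite \<kappa>" using i inf \<kappa> by blast+
    ultimately have "b i \<le>o \<kappa>" by (intro is_beth_ordLeq[OF WO _ b])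
    with i show ?thesis by blast
  qed
  then obtain l1 where l1: "\<And>\<kappa>. \<kappa> \<in> K1 \<Longrightarrow> l1 \<kappa> \<in> Field W \<and> \<kappa> <o ctwo ^c b (l1 \<kappa>) \<and> b (l1 \<kappa>) \<le>o \<kappa>"
    by metis
  \<comment> \<open>A proper initial segment of the cardinal |K| is smaller than |K|, so it cannot
    bound all the powers whose supremum is |K|.\<close>
  have "\<exists>i\<in>Field W. |underS |K| \<kappa>| <o ctwo ^c b i" if "\<kappa> \<in> K" for \<kappa>
  proof (rule ccontr)
    assume "\<not> ?thesis"
    then have "\<forall>i\<in>Field W. ctwo ^c b i \<le>o |underS |K| \<kappa>|"
      using not_ordLess_iff_ordLeq[OF wo2 card_of_Well_order] by blast
    then have "|K| \<le>o |underS |K| \<kappa>|" using sup by (simp add: is_card_sup_def)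
    moreover have "|underS |K| \<kappa>| <o |K|" using that by (intro card_of_underS) (auto simp: Field_card_of)
    ultimately show False using not_ordLess_ordLeq by metis
  qed
  then obtain l2 where l2: "\<And>\<kappa>. \<kappa> \<in> K \<Longrightarrow> l2 \<kappa> \<in> Field W \<and> |underS |K| \<kappa>| <o ctwo ^c b (l2 \<kappa>)"
    by metis
  define lev where "lev \<kappa> = (if \<kappa> \<in> K1 then l1 \<kappa> else l2 \<kappa>)" for \<kappa>
  have lev: "lev \<kappa> \<in> Field W" if "\<kappa> \<in> K" for \<kappa> using l1 l2 that by (simp add: lev_def)
  have ble: "b (lev \<kappa>) \<le>o \<kappa>" if "\<kappa> \<in> K" for \<kappa>
  proof (cases "\<kappa> \<in> K1")
    case True
    then show ?thesis using l1 by (simp add: lev_def)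
  next
    case False
    then have "\<not> \<kappa> <o ctwo ^c b (lev \<kappa>)" using lev[OF that] that by (auto simp: K1_def)
    then have "ctwo ^c b (lev \<kappa>) \<le>o \<kappa>" using not_ordLess_iff_ordLeq[OF wo2 wo\<kappa>[OF that]] by blast
    with ordLess_ctwo_cexp[OF cb[OF lev[OF that]]] show ?thesis
      by (rule ordLess_imp_ordLeq[OF ordLess_ordLeq_trans])
  qed
  have "|{\<kappa> \<in> K. lev \<kappa> = i}| \<le>o |Pow (Field (b i))|" if i: "i \<in> Field W" for i
  proof -
    \<comment> \<open>Here the cardinals themselves are the pairwise non-isomorphic short
      well-orders; outside \<open>K1\<close> their initial segments in \<open>K\<close> take that
      role.\<close>
    have "|{\<kappa> \<in> K1. lev \<kappa> = i}| \<le>o ctwo ^c b i"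
    proof (rule card_of_small_ordinals[OF Card_order_cexp])
      show "\<kappa> <o ctwo ^c b i" if "\<kappa> \<in> {\<kappa> \<in> K1. lev \<kappa> = i}" for \<kappa> using that l1 by (auto simp: lev_def)
      show "\<kappa> = \<mu>" if "\<kappa> \<in> {\<kappa> \<in> K1. lev \<kappa> = i}" "\<mu> \<in> {\<kappa> \<in> K1. lev \<kappa> = i}" "\<kappa> =o \<mu>" for \<kappa> \<mu>
        using that distinct by (auto simp: pairwise_def K1_def)
    qed
    moreover have "|{\<kappa> \<in> K - K1. lev \<kappa> = i}| \<le>o ctwo ^c b i"
    proof (rule card_of_small_ordinals[OF Card_order_cexp])
      let ?o = "\<lambda>\<kappa>. Restr |K| (underS |K| \<kappa>)"
      show "?o \<kappa> <o ctwo ^c b i" if "\<kappa> \<in> {\<kappa> \<in> K - K1. lev \<kappa> = i}" for \<kappa>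
        using that l2 by (intro ordLess_card_of_imp_Restr_underS_ordLess Card_order_cexp card_of_Well_order) (auto simp: lev_def)
      show "\<kappa> = \<mu>" if "\<kappa> \<in> {\<kappa> \<in> K - K1. lev \<kappa> = i}" "\<mu> \<in> {\<kappa> \<in> K - K1. lev \<kappa> = i}" "?o \<kappa> =o ?o \<mu>" for \<kappa> \<mu>
        using that by (intro underS_inj[OF card_of_Well_order]) (auto simp: Field_card_of)
    qed
    ultimately have "|{\<kappa> \<in> K1. lev \<kappa> = i} \<union> {\<kappa> \<in> K - K1. lev \<kappa> = i}| \<le>o ctwo ^c b i"
      using two[OF i] by (intro card_of_Un_ordLeq_infinite_Field) (auto simp: cinfinite_def)
    moreover have "{\<kappa> \<in> K1. lev \<kappa> = i} \<union> {\<kappa> \<in> K - K1. lev \<kappa> = i} = {\<kappa> \<in> K. lev \<kappa> = i}"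
      by (auto simp: K1_def)
    ultimately have "|{\<kappa> \<in> K. lev \<kappa> = i}| \<le>o ctwo ^c b i" by simp
    also have "ctwo ^c b i =o ctwo ^c |Field (b i)|"
      by (rule cexp_ctwo_cong[OF ordIso_symmetric[OF card_of_Field_ordIso[OF cb[OF i]]] cb[OF i]])
    also have "ctwo ^c |Field (b i)| =o |Pow (Field (b i))|" by (rule ordIso_symmetric[OF Pow_cexp_ctwo])
    finally show ?thesis .
  qed
  \<comment> \<open>The injection \<open>f i\<close> of the members of level \<open>i\<close> into
    the subsets of \<open>Field (b i)\<close> supplies the marks \<open>Q\<close>.\<close>
  then have "\<forall>i\<in>Field W. \<exists>f. inj_on f {\<kappa> \<in> K. lev \<kappa> = i} \<and> f ` {\<kappa> \<in> K. lev \<kappa> = i} \<subseteq> Pow (Field (b i))"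
    unfolding card_of_ordLeq by (rule ballI)
  from bchoice[OF this] obtain f where
    f: "\<And>i. i \<in> Field W \<Longrightarrow> inj_on (f i) {\<kappa> \<in> K. lev \<kappa> = i} \<and> f i ` {\<kappa> \<in> K. lev \<kappa> = i} \<subseteq> Pow (Field (b i))"
    by blast
  show thesis
  proof (rule that[of "\<lambda>i. Field (b i)" lev "\<lambda>\<kappa>. f (lev \<kappa>) \<kappa>"])
    fix \<kappa> assume \<kappa>: "\<kappa> \<in> K"
    have "cinfinite (b (lev \<kappa>))"
      using cinfinite_mono[OF natLeq_ordLeq_is_beth[OF b[OF lev[OF \<kappa>]]] natLeq_cinfinite] .
    then show "Field (b (lev \<kappa>)) \<noteq> {}" by (auto simp: cinfinite_def)
    show "|Field (b (lev \<kappa>))| \<le>o \<kappa>"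
      by (rule ordIso_ordLeq_trans[OF card_of_Field_ordIso[OF cb[OF lev[OF \<kappa>]]] ble[OF \<kappa>]])
    show "f (lev \<kappa>) \<kappa> \<subseteq> Field (b (lev \<kappa>))" using f[OF lev[OF \<kappa>]] \<kappa> by blast
  next
    show "inj_on (\<lambda>\<kappa>. (lev \<kappa>, f (lev \<kappa>) \<kappa>)) K"
    proof (rule inj_onI)
      fix \<kappa> \<mu> assume k: "\<kappa> \<in> K" "\<mu> \<in> K" "(lev \<kappa>, f (lev \<kappa>) \<kappa>) = (lev \<mu>, f (lev \<mu>) \<mu>)"
      have "inj_on (f (lev \<kappa>)) {\<kappa>' \<in> K. lev \<kappa>' = lev \<kappa>}" using f[OF lev[OF k(1)]] by blast
      moreover have l: "lev \<kappa> = lev \<mu>" "f (lev \<kappa>) \<kappa> = f (lev \<mu>) \<mu>" using k(3) unfolding prod.inject by blast+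
      have "f (lev \<kappa>) \<kappa> = f (lev \<kappa>) \<mu>" unfolding l(1) using l(2)[unfolded l(1)] .
      ultimately show "\<kappa> = \<mu>" using k(1,2) l(1)[symmetric] unfolding inj_on_def by blast
    qed
  qed
qed


section \<open>Construction of the family\<close>

theorem theorem2:
  fixes K :: "'a rel set"
  assumes "\<forall>\<kappa>\<in>K. Cinfinite \<kappa>"
    and "pairwise (\<lambda>\<kappa> \<mu>. \<not> \<kappa> =o \<mu>) K"
    and "is_beth omega1 |K|"
  shows "\<exists>\<F> :: 'a monoid set.
           (\<forall>G\<in>\<F>. group G \<and> F_universal G) \<and>
           pairwise (\<lambda>G H. \<not> embeds G H) \<F> \<and>
           (\<forall>\<kappa>\<in>K. |{G \<in> \<F>. |carrier G| =o \<kappa>}| =o ctwo ^c \<kappa>)"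
proof -
  have "Field omega1 \<noteq> {}"
    by (rule Field_cardSuc_not_empty[OF natLeq_Card_order])
  then obtain lev :: "'a rel \<Rightarrow> nat set" and B :: "nat set \<Rightarrow> 'a rel set" and Q :: "'a rel \<Rightarrow> 'a rel set"
    where ne: "\<And>\<kappa>. \<kappa> \<in> K \<Longrightarrow> B (lev \<kappa>) \<noteq> {}"
      and le: "\<And>\<kappa>. \<kappa> \<in> K \<Longrightarrow> |B (lev \<kappa>)| \<le>o \<kappa>" and Q: "\<And>\<kappa>. \<kappa> \<in> K \<Longrightarrow> Q \<kappa> \<subseteq> B (lev \<kappa>)"
      and inj: "inj_on (\<lambda>\<kappa>. (lev \<kappa>, Q \<kappa>)) K"
    by (rule beth_levels[OF assms]) (rule that)
  \<comment> \<open>Since \<open>omega1\<close> is a well-order on sets of naturals, the level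
    \<open>lev \<kappa>\<close> is its own code.\<close>
  define M where "M \<kappa> P = marked_group (B (lev \<kappa>)) (lev \<kappa>) (Q \<kappa>) (Field \<kappa>) P" for \<kappa> :: "'a rel" and P
  have inf: "infinite (Field \<kappa>)" and co: "Card_order \<kappa>" if "\<kappa> \<in> K" for \<kappa>
    using assms(1) that by (auto simp: cinfinite_def)
  have cardM: "|carrier (M \<kappa> P)| =o |Field \<kappa>|" if "\<kappa> \<in> K" for \<kappa> P
    unfolding M_def
  proof (rule card_of_marked_group[OF inf[OF that]])
    show "|B (lev \<kappa>)| \<le>o |Field \<kappa>|"
      by (rule ordLeq_ordIso_trans[OF le[OF that] ordIso_symmetric[OF card_of_Field_ordIso[OF co[OF that]]]])
  qed
  have "\<exists>e. bij_betw e (carrier (M \<kappa> P)) (Field \<kappa>)" if "\<kappa> \<in> K" for \<kappa> P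
    using cardM[OF that] by (simp only: card_of_ordIso)
  then obtain e where e: "\<And>\<kappa> P. \<kappa> \<in> K \<Longrightarrow> bij_betw (e \<kappa> P) (carrier (M \<kappa> P)) (Field \<kappa>)" by metis
  define T where "T \<kappa> P = transport (e \<kappa> P) (M \<kappa> P)" for \<kappa> P
  have gM: "group (M \<kappa> P)" for \<kappa> P unfolding M_def by (rule group_marked_group)
  note tr = transport[OF gM bij_betw_imp_inj_on[OF e], folded T_def]
  have carT: "carrier (T \<kappa> P) = Field \<kappa>" if "\<kappa> \<in> K" for \<kappa> P
    using tr(4)[OF that] bij_betw_imp_surj_on[OF e[OF that]] by simp
  have rigid: "\<kappa> = \<mu> \<and> P = P'"
    if k: "\<kappa> \<in> K" "\<mu> \<in> K" "P \<subseteq> Field \<kappa>" "P' \<subseteq> Field \<mu>" and emb: "embeds (T \<kappa> P) (T \<mu> P')" for \<kappa> \<mu> P P'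
  proof -
    have "embeds (M \<kappa> P) (M \<mu> P')"
      by (rule embeds_trans[OF tr(2)[OF k(1)] embeds_trans[OF emb tr(3)[OF k(2)]]])
    note rig = marked_group_embeds[OF this[unfolded M_def] ne[OF k(1)]]
    have A: "Field \<kappa> \<noteq> {}" using inf[OF k(1)] by auto
    \<comment> \<open>The order matters: equal levels make the sets \<open>B\<close> equal, then the
      marks \<open>Q\<close> agree, which gives \<kappa> = \<mu> by injectivity, and only then do
      the fields coincide so that \<open>P\<close> and \<open>P'\<close> can be compared.\<close>
    have lev: "lev \<kappa> = lev \<mu>" by (rule rig(1)[OF A]) simp
    have "Q \<kappa> \<inter> B (lev \<kappa>) = Q \<mu> \<inter> B (lev \<kappa>)" by (rule rig(2)[OF A]) simp
    then have "Q \<kappa> = Q \<mu>" using Q[OF k(1)] Q[OF k(2)] lev by auto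
    with lev have eq: "\<kappa> = \<mu>" using inj_onD[OF inj _ k(1,2)] by simp
    then have "P \<inter> Field \<kappa> = P' \<inter> Field \<kappa>" by (intro rig(3)[OF A]) simp_all
    with eq k(3,4) show ?thesis by blast
  qed
  \<comment> \<open>With \<open>rigid\<close>, this makes \<open>T \<kappa>\<close> injective: equal
    groups embed into each other, so their marked subsets are equal.\<close>
  have refl: "embeds (T \<kappa> P) (T \<kappa> P)" for \<kappa> P
    by (rule embedsI[of id]) (simp add: mon_def hom_def)
  define \<F> where "\<F> = (\<Union>\<kappa>\<in>K. T \<kappa> ` Pow (Field \<kappa>))"
  have "group G \<and> F_universal G" if "G \<in> \<F>" for G
  proof -
    obtain \<kappa> P where G: "\<kappa> \<in> K" "G = T \<kappa> P" using \<open>G \<in> \<F>\<close> by (auto simp: \<F>_def)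
    have "F_universal (M \<kappa> P)" unfolding M_def by (rule F_universal_marked_group)
    then show ?thesis using F_universal_embeds tr(1,2)[OF G(1)] G(2) by blast
  qed
  moreover have "pairwise (\<lambda>G H. \<not> embeds G H) \<F>"
    unfolding pairwise_def \<F>_def using rigid by blast
  moreover have "|{G \<in> \<F>. |carrier G| =o \<kappa>}| =o ctwo ^c \<kappa>" if \<kappa>: "\<kappa> \<in> K" for \<kappa>
  proof -
    have "{G \<in> \<F>. |carrier G| =o \<kappa>} = T \<kappa> ` Pow (Field \<kappa>)"
    proof
      show "{G \<in> \<F>. |carrier G| =o \<kappa>} \<subseteq> T \<kappa> ` Pow (Field \<kappa>)"
      proof
        fix G assume "G \<in> {G \<in> \<F>. |carrier G| =o \<kappa>}"
        then obtain \<mu> P where G: "\<mu> \<in> K" "P \<subseteq> Field \<mu>" "G = T \<mu> P" "|carrier G| =o \<kappa>"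
          by (auto simp: \<F>_def)
        have "\<mu> =o |Field \<mu>|" by (rule ordIso_symmetric[OF card_of_Field_ordIso[OF co[OF G(1)]]])
        then have "\<mu> =o \<kappa>" using G(4) by (simp add: G(3) carT[OF G(1)] ordIso_transitive[of \<mu>])
        then have "\<mu> = \<kappa>" using assms(2) G(1) \<kappa> by (auto simp: pairwise_def)
        with G show "G \<in> T \<kappa> ` Pow (Field \<kappa>)" by blast
      qed
      show "T \<kappa> ` Pow (Field \<kappa>) \<subseteq> {G \<in> \<F>. |carrier G| =o \<kappa>}"
        using \<kappa> card_of_Field_ordIso[OF co[OF \<kappa>]] by (auto simp: \<F>_def carT[OF \<kappa>])
    qed
    moreover have "inj_on (T \<kappa>) (Pow (Field \<kappa>))"
    proof (rule inj_onI)
      fix P P' assume P: "P \<in> Pow (Field \<kappa>)" "P' \<in> Pow (Field \<kappa>)" "T \<kappa> P = T \<kappa> P'"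
      then have "embeds (T \<kappa> P) (T \<kappa> P')" using refl[of \<kappa> P] by simp
      then show "P = P'" using rigid[OF \<kappa> \<kappa>] P by blast
    qed
    ultimately have "|Pow (Field \<kappa>)| =o |{G \<in> \<F>. |carrier G| =o \<kappa>}|"
      by (intro card_of_ordIsoI[of "T \<kappa>"]) (simp add: bij_betw_def)
    then have "|{G \<in> \<F>. |carrier G| =o \<kappa>}| =o |Pow (Field \<kappa>)|" by (rule ordIso_symmetric)
    also have "|Pow (Field \<kappa>)| =o ctwo ^c |Field \<kappa>|" by (rule Pow_cexp_ctwo)
    also have "ctwo ^c |Field \<kappa>| =o ctwo ^c \<kappa>"
      by (rule cexp_ctwo_cong[OF card_of_Field_ordIso[OF co[OF \<kappa>]] card_of_Card_order])
    finally show ?thesis .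
  qed
  ultimately show ?thesis by blast
qed

end
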